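(* Among the connected strongly regular graphs with smallest eigenvalue $-2$, the only counterexamples to Brouwer's Conjecture are the triangular graphs $T(m)$ with $m\geq 6$. That is, a connected strongly regular graph $G$ with smallest eigenvalue $-2$ is a counterexample to Brouwer's Conjecture if and only if $G$ is isomorphic to $T(m)$ for some $m\geq 6$.
   Context: All graphs are finite and simple. A graph $G$ is a $(v,k,\lambda,\mu)$-SRG (strongly regular graph) if it has $v$ vertices, is $k$-regular, any two adjacent vertices have exactly $\lambda$ common neighbors, and any two distinct non-adjacent vertices have exactly $\mu$ common neighbors. Eigenvalues are those of the adjacency matrix. A disconnecting set of a connected graph $G$ is a set $S$ of vertices such that $G\setminus S$ is disconnected. Brouwer's Conjecture asserts that if $G$ is a connected $(v,k,\lambda,\mu)$-SRG and $S$ is a disconnecting set of $G$ such that every component of $G\setminus S$ has at least two vertices, then $|S|\geq 2k-\lambda-2$; a connected $(v,k,\lambda,\mu)$-SRG $G$ is a counterexample if it has a disconnecting set $S$ such that every component of $G\setminus S$ has at least two vertices and $|S|<2k-\lambda-2$. The triangular graph $T(m)$ has as vertices the $2$-subsets of $\{1,\dots,m\}$, two being adjacent if and only if they intersect in exactly one element. *)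

theory Defs
  imports
    "Graph_Theory.Digraph_Component"
    "Graph_Theory.Digraph_Isomorphism"
    "Jordan_Normal_Form.Char_Poly"
begin

text \<open>
  Finite simple graphs are the symmetric digraphs of locale \<^locale>\<open>graph\<close> (finite, without loops or
  parallel arcs): an undirected edge is a pair of opposite arcs, and \<open>u \<rightarrow>\<^bsub>G\<^esub> v\<close> is adjacency.
  The name \<open>connected\<close> is also used for topological spaces, so the graph notion is qualified
  below.
\<close>

definition neighbors :: "('a, 'b) pre_digraph \<Rightarrow> 'a \<Rightarrow> 'a set" where
  "neighbors G u = {w \<in> verts G. u \<rightarrow>\<^bsub>G\<^esub> w}"

definition srg :: "('a, 'b) pre_digraph \<Rightarrow> nat \<Rightarrow> nat \<Rightarrow> nat \<Rightarrow> nat \<Rightarrow> bool" where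
  "srg G v k l \<mu> \<longleftrightarrow>
     graph G \<and>
     card (verts G) = v \<and>
     (\<forall>x \<in> verts G. card (neighbors G x) = k) \<and>
     (\<forall>x \<in> verts G. \<forall>y \<in> verts G. x \<rightarrow>\<^bsub>G\<^esub> y \<longrightarrow>
        card (neighbors G x \<inter> neighbors G y) = l) \<and>
     (\<forall>x \<in> verts G. \<forall>y \<in> verts G. x \<noteq> y \<and> \<not> x \<rightarrow>\<^bsub>G\<^esub> y \<longrightarrow>
        card (neighbors G x \<inter> neighbors G y) = \<mu>)"

definition strongly_regular :: "('a, 'b) pre_digraph \<Rightarrow> bool" where
  "strongly_regular G \<longleftrightarrow> (\<exists>v k l \<mu>. srg G v k l \<mu>)"

definition adjacency_mat :: "('a, 'b) pre_digraph \<Rightarrow> 'a list \<Rightarrow> real mat" where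
  "adjacency_mat G vs =
     mat (length vs) (length vs) (\<lambda>(i, j). if vs ! i \<rightarrow>\<^bsub>G\<^esub> vs ! j then 1 else 0)"

text \<open>
  Different enumerations \<open>vs\<close> of the vertices give permutation-similar matrices, so the
  eigenvalues do not depend on the choice of \<open>vs\<close>. As these matrices are symmetric, all their
  eigenvalues are real.
\<close>

definition graph_eigenvalue :: "('a, 'b) pre_digraph \<Rightarrow> real \<Rightarrow> bool" where
  "graph_eigenvalue G \<theta> \<longleftrightarrow>
     (\<exists>vs. distinct vs \<and> set vs = verts G \<and> eigenvalue (adjacency_mat G vs) \<theta>)"

definition smallest_eigenvalue :: "('a, 'b) pre_digraph \<Rightarrow> real \<Rightarrow> bool" where
  "smallest_eigenvalue G \<theta> \<longleftrightarrow>
     graph_eigenvalue G \<theta> \<and> (\<forall>\<eta>. graph_eigenvalue G \<eta> \<longrightarrow> \<theta> \<le> \<eta>)"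

text \<open>
  The library's \<^const>\<open>Digraph_Component.connected\<close> is false for the graph without vertices; the
  condition \<open>S \<noteq> verts G\<close> prevents the whole vertex set from counting as a disconnecting set.
\<close>

definition disconnecting_set :: "('a, 'b) pre_digraph \<Rightarrow> 'a set \<Rightarrow> bool" where
  "disconnecting_set G S \<longleftrightarrow>
     S \<subseteq> verts G \<and> S \<noteq> verts G \<and> \<not> Digraph_Component.connected (G \<restriction> (verts G - S))"

text \<open>
  In a symmetric digraph the strongly connected components are the connected components of the
  undirected graph. The bound is stated over the integers to avoid truncated subtraction.
\<close>

definition brouwer_counterexample :: "('a, 'b) pre_digraph \<Rightarrow> bool" where
  "brouwer_counterexample G \<longleftrightarrow>
     Digraph_Component.connected G \<and>
     (\<exists>v k l \<mu> S.
        srg G v k l \<mu> \<and>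
        disconnecting_set G S \<and>
        (\<forall>C \<in> pre_digraph.sccs (G \<restriction> (verts G - S)). 2 \<le> card (verts C)) \<and>
        int (card S) < 2 * int k - int l - 2)"

definition triangular_graph :: "nat \<Rightarrow> (nat set, nat set \<times> nat set) pre_digraph" where
  "triangular_graph m =
     (let V = {A. A \<subseteq> {1..m} \<and> card A = 2}
      in \<lparr>verts = V, arcs = {(A, B) \<in> V \<times> V. card (A \<inter> B) = 1}, tail = fst, head = snd\<rparr>)"

end

theory Submission
  imports Defs
begin

text \<open>
  A strongly regular graph with restricted eigenvalues \<open>-2\<close> and \<open>r\<close> has \<open>k = 2r + \<mu>\<close> and
  \<open>\<lambda> = r + \<mu> - 2\<close>, and \<open>M = A + 2I\<close> satisfies \<open>M\<^sup>2 = (r + 2)M + \<mu>J\<close>. Hence \<open>M\<close> is positive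
  semidefinite, and evaluating the identity at short integral vectors restricts induced subgraphs.

  If there is an induced claw, then \<open>\<mu> = r \<le> 4\<close>. If there is none, every induced path of length 2
  lies in a unique induced 4-cycle; counting in the neighbourhood of a vertex then gives
  \<open>\<mu> \<in> {2, 4}\<close> or \<open>\<mu> = r + 4 \<le> 8\<close>. In the last case the common non-neighbours of an
  edge or of three vertices are too few to leave room for both sides of a cut of fewer than
  \<open>2k - \<lambda> - 2 = 3r + \<mu>\<close> vertices. In the other cases Cauchy--Schwarz, applied to the numbers of
  neighbours that the vertices have in one side of the cut, forces \<open>\<mu> = 4\<close> and a side that is a
  triangle whose three vertices have no common neighbour, and such that each outside vertex is
  adjacent to none or to two of them. A parity argument excludes this in the presence of a claw.
  Without claws, the neighbourhoods of its vertices, and by connectivity all neighbourhoods, are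
  unions of two cliques, and these cliques identify the graph with \<open>T(r + 4)\<close>.

  Conversely, \<open>{1,2}, {1,3}, {2,3}\<close> is cut off in \<open>T(m)\<close> by its \<open>3(m - 3) = 2k - \<lambda> - 3\<close> neighbours.
\<close>

text \<open>The form turns the vertices into vectors of norm 2 with mutual inner products 0 and 1,
  as in a root lattice. If an integral combination of vertices has coefficient sum \<open>h\<close>
  and norm \<open>q\<close>, its inner products \<open>e\<close> with all vertices have sum
  \<open>(2r + \<mu> + 2) h\<close> and sum of squares \<open>(r + 2) q + \<mu> h^2\<close>. For
  \<open>h = 1\<close> and \<open>q = 2\<close> the sum of all \<open>e (e - 1)\<close> is therefore
  2, whatever the parameters, and every term is a nonnegative even integer: all \<open>e\<close> are
  0 or 1 except a single one, which is -1 or 2. For \<open>h = q = 0\<close> all \<open>e\<close>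
  vanish, which is a linear relation between vertices. These two consequences take the place of a
  classification of the graphs with smallest eigenvalue -2. The number
  \<open>2k - \<lambda> - 2 = 3r + \<mu>\<close> counts the vertices whose removal isolates an edge.
  A counterexample has to beat this cut, and the triangles in \<open>T(m)\<close> beat it by a
  single vertex, so the estimates have no slack.\<close>

lemma sum_sq_le_card_mult:
  fixes f :: "'b \<Rightarrow> 'c :: linordered_idom"
  shows "(\<Sum>v\<in>A. f v)\<^sup>2 \<le> of_nat (card A) * (\<Sum>v\<in>A. (f v)\<^sup>2)"
proof (cases "card A = 0")
  case True
  then have "(\<Sum>v\<in>A. f v) = 0" by (cases "finite A") auto
  then show ?thesis by (simp add: True)
next
  case False
  define n s where "n = (of_nat (card A) :: 'c)" and "s = (\<Sum>v\<in>A. f v)"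
  \<comment> \<open>The deviations from the mean \<open>s / n\<close> are multiplied by
    \<open>n\<close>, because the inequality is to serve for integers as well.\<close>
  have "0 \<le> (\<Sum>v\<in>A. (n * f v - s)\<^sup>2)" by (simp add: sum_nonneg)
  also have "\<dots> = (\<Sum>v\<in>A. n\<^sup>2 * (f v)\<^sup>2 - 2 * n * s * f v + s\<^sup>2)"
    by (intro sum.cong) (simp_all add: power2_eq_square algebra_simps)
  also have "\<dots> = n\<^sup>2 * (\<Sum>v\<in>A. (f v)\<^sup>2) - 2 * n * s * s + n * s\<^sup>2"
    by (simp add: sum.distrib sum_subtractf n_def s_def flip: sum_distrib_left)
  also have "\<dots> = n * (n * (\<Sum>v\<in>A. (f v)\<^sup>2) - s\<^sup>2)"
    by (simp add: power2_eq_square algebra_simps)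
  finally have "0 \<le> n * (n * (\<Sum>v\<in>A. (f v)\<^sup>2) - s\<^sup>2)" .
  moreover have "n > 0" using False by (simp add: n_def)
  ultimately show ?thesis by (simp add: zero_le_mult_iff n_def s_def)
qed

section \<open>The form \<open>A + 2I\<close>\<close>

text \<open>The equations \<open>k = 2r + \<mu>\<close> and \<open>\<lambda> + 2 = r + \<mu>\<close> express that the restricted eigenvalues
  are \<open>-2\<close> and \<open>r\<close>.\<close>

locale srg_neg2 =
  fixes V :: "'a set" and adj :: "'a \<Rightarrow> 'a \<Rightarrow> bool" and r \<mu> :: nat
  assumes finite_V: "finite V"
    and adj_sym: "adj x y \<Longrightarrow> adj y x"
    and adj_irrefl: "\<not> adj x x"
    and adj_V: "adj x y \<Longrightarrow> x \<in> V"
    and degree: "x \<in> V \<Longrightarrow> card {w. adj x w} = 2 * r + \<mu>"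
    and common_adj: "adj x y \<Longrightarrow> card ({w. adj x w} \<inter> {w. adj y w}) + 2 = r + \<mu>"
    and common_nonadj: "x \<in> V \<Longrightarrow> y \<in> V \<Longrightarrow> x \<noteq> y \<Longrightarrow> \<not> adj x y \<Longrightarrow>
          card ({w. adj x w} \<inter> {w. adj y w}) = \<mu>"
    and mu_pos: "\<mu> > 0"
begin

abbreviation nbh :: "'a \<Rightarrow> 'a set" where "nbh x \<equiv> {w. adj x w}"

lemma adj_V2: "adj x y \<Longrightarrow> y \<in> V"
  using adj_sym adj_V by blast

lemma adj_commute: "adj x y \<longleftrightarrow> adj y x"
  using adj_sym by blast

lemma adj_neq: "adj x y \<Longrightarrow> x \<noteq> y"
  using adj_irrefl by blast

lemma nbh_subset: "nbh x \<subseteq> V"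
  using adj_V2 by blast

lemma finite_nbh [simp]: "finite (nbh x)"
  using finite_subset[OF nbh_subset finite_V] .

lemma finite_sub: "X \<subseteq> V \<Longrightarrow> finite X"
  using finite_subset finite_V by blast

text \<open>The entries of \<open>M\<close>, kept as integers because integrality
  (\<open>e (e - 1) \<ge> 0\<close>) and parity of inner products are what the proof
  exploits.\<close>

definition gram :: "'a \<Rightarrow> 'a \<Rightarrow> int" where
  "gram x y = (if x = y then 2 else if adj x y then 1 else 0)"

definition gram_row :: "'a \<Rightarrow> 'a set \<Rightarrow> int" where
  "gram_row v X = (\<Sum>x\<in>X. gram v x)"

definition gram_sum :: "'a set \<Rightarrow> 'a set \<Rightarrow> int" where
  "gram_sum X Y = (\<Sum>x\<in>X. gram_row x Y)"

lemma gram_self [simp]: "gram x x = 2"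
  by (simp add: gram_def)

lemma gram_adj: "adj x y \<Longrightarrow> gram x y = 1"
  by (auto simp: gram_def adj_irrefl)

lemma gram_nonadj: "x \<noteq> y \<Longrightarrow> \<not> adj x y \<Longrightarrow> gram x y = 0"
  by (simp add: gram_def)

lemma gram_commute: "gram x y = gram y x"
  by (auto simp: gram_def adj_commute)

lemma gram_adj': "adj x y \<Longrightarrow> gram y x = 1"
  and gram_nonadj': "x \<noteq> y \<Longrightarrow> \<not> adj x y \<Longrightarrow> gram y x = 0"
  by (metis gram_adj gram_commute, metis gram_nonadj gram_commute)

lemma gram_of_bool: "gram v x = 2 * of_bool (v = x) + of_bool (adj x v)"
  using adj_irrefl adj_sym by (auto simp: gram_def)

lemma gram_row_singleton [simp]: "gram_row v {x} = gram v x"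
  by (simp add: gram_row_def)

lemma gram_sum_singleton_left: "gram_sum {x} Y = gram_row x Y"
  by (simp add: gram_sum_def)

lemma gram_sum_commute: "gram_sum X Y = gram_sum Y X"
  unfolding gram_sum_def gram_row_def by (subst sum.swap) (simp add: gram_commute)

lemma gram_sum_singleton_right: "gram_sum X {y} = gram_row y X"
  using gram_sum_singleton_left gram_sum_commute by metis

lemma sum_gram:
  assumes "x \<in> V"
  shows "(\<Sum>v\<in>V. gram v x) = 2 * int r + int \<mu> + 2"
proof -
  have "V \<inter> nbh x = nbh x" using nbh_subset by blast
  then have "(\<Sum>v\<in>V. (of_bool (adj x v) :: int)) = 2 * int r + int \<mu>"
    using degree[OF assms] finite_V by (simp add: sum_of_bool_eq Int_def)
  moreover have "(\<Sum>v\<in>V. (of_bool (v = x) :: int)) = 1"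
    using assms finite_V by simp
  ultimately show ?thesis
    by (simp add: gram_of_bool sum.distrib flip: sum_distrib_left)
qed

text \<open>Entrywise, \<open>M^2 = 4I + 4A + A^2 = (r + 2)M + \<mu>J\<close>; the degree,
  \<open>\<lambda>\<close> and \<open>\<mu>\<close> settle the diagonal, the edges and the
  non-edges.\<close>

lemma sum_gram_gram:
  assumes "x \<in> V" "y \<in> V"
  shows "(\<Sum>v\<in>V. gram v x * gram v y) = (int r + 2) * gram x y + int \<mu>"
proof -
  have 1: "gram v x * gram v y = 4 * of_bool (v = x \<and> x = y) + 2 * of_bool (v = x \<and> adj y x)
      + 2 * of_bool (v = y \<and> adj x y) + of_bool (v \<in> nbh x \<inter> nbh y)" for v
    using adj_irrefl adj_sym by (auto simp: gram_def)
  have sing: "(\<Sum>v\<in>V. (of_bool (v = w \<and> P) :: int)) = of_bool P" if "w \<in> V" for w P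
    using that finite_V by (cases P) auto
  have nb: "(\<Sum>v\<in>V. (of_bool (v \<in> nbh x \<inter> nbh y) :: int)) = int (card (nbh x \<inter> nbh y))"
  proof -
    have "V \<inter> {v. v \<in> nbh x \<inter> nbh y} = nbh x \<inter> nbh y" using nbh_subset by blast
    then show ?thesis using finite_V by (simp only: sum_of_bool_eq)
  qed
  have "(\<Sum>v\<in>V. gram v x * gram v y) = 4 * of_bool (x = y) + 2 * of_bool (adj y x)
      + 2 * of_bool (adj x y) + int (card (nbh x \<inter> nbh y))"
    by (simp only: 1 sum.distrib sum_distrib_left[symmetric] nb sing[OF assms(1)] sing[OF assms(2)])
  moreover consider "x = y" | "adj x y" "x \<noteq> y" | "\<not> adj x y" "x \<noteq> y" by blast
  then have "4 * of_bool (x = y) + 2 * of_bool (adj y x)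
      + 2 * of_bool (adj x y) + int (card (nbh x \<inter> nbh y)) = (int r + 2) * gram x y + int \<mu>"
  proof cases
    case 1
    then show ?thesis using degree[OF assms(1)] by (simp add: adj_irrefl)
  next
    case 2
    then show ?thesis using common_adj[OF 2(1)] adj_sym[of x y] by (simp add: gram_adj)
  next
    case 3
    then show ?thesis using common_nonadj[OF assms] adj_sym[of y x] by (auto simp: gram_nonadj)
  qed
  ultimately show ?thesis by simp
qed

lemma sum_gram_row:
  assumes "X \<subseteq> V"
  shows "(\<Sum>v\<in>V. gram_row v X) = (2 * int r + int \<mu> + 2) * int (card X)"
proof -
  have "(\<Sum>v\<in>V. gram_row v X) = (\<Sum>x\<in>X. \<Sum>v\<in>V. gram v x)"
    unfolding gram_row_def by (rule sum.swap)
  also have "\<dots> = (\<Sum>x\<in>X. 2 * int r + int \<mu> + 2)"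
    using assms by (intro sum.cong) (auto simp: sum_gram)
  finally show ?thesis by (simp add: mult.commute)
qed

lemma sum_gram_row_gram_row:
  assumes "X \<subseteq> V" "Y \<subseteq> V"
  shows "(\<Sum>v\<in>V. gram_row v X * gram_row v Y) = (int r + 2) * gram_sum X Y + int \<mu> * int (card X) * int (card Y)"
proof -
  have "(\<Sum>v\<in>V. gram_row v X * gram_row v Y) = (\<Sum>v\<in>V. \<Sum>x\<in>X. \<Sum>y\<in>Y. gram v x * gram v y)"
    by (simp add: gram_row_def sum_product)
  also have "\<dots> = (\<Sum>x\<in>X. \<Sum>v\<in>V. \<Sum>y\<in>Y. gram v x * gram v y)"
    by (rule sum.swap)
  also have "\<dots> = (\<Sum>x\<in>X. \<Sum>y\<in>Y. \<Sum>v\<in>V. gram v x * gram v y)"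
    by (intro sum.cong refl sum.swap)
  also have "\<dots> = (\<Sum>x\<in>X. \<Sum>y\<in>Y. (int r + 2) * gram x y + int \<mu>)"
    using assms by (intro sum.cong refl sum_gram_gram) auto
  also have "\<dots> = (int r + 2) * gram_sum X Y + int \<mu> * int (card X) * int (card Y)"
    by (simp add: gram_sum_def gram_row_def sum.distrib sum_distrib_left algebra_simps)
  finally show ?thesis .
qed

text \<open>Integral vectors in the span of the vertices are encoded as lists of pairs \<open>(c, X)\<close>, standing
  for \<open>c\<close> times the characteristic vector of \<open>X\<close>.\<close>

definition form :: "(int \<times> 'a set) list \<Rightarrow> int" where
  "form L = (\<Sum>(c, X)\<leftarrow>L. \<Sum>(d, Y)\<leftarrow>L. c * d * gram_sum X Y)"

definition height :: "(int \<times> 'a set) list \<Rightarrow> int" where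
  "height L = (\<Sum>(c, X)\<leftarrow>L. c * int (card X))"

definition ev :: "(int \<times> 'a set) list \<Rightarrow> 'a \<Rightarrow> int" where
  "ev L v = (\<Sum>(c, X)\<leftarrow>L. c * gram_row v X)"

definition supported :: "(int \<times> 'a set) list \<Rightarrow> bool" where
  "supported L \<longleftrightarrow> (\<forall>(c, X)\<in>set L. X \<subseteq> V)"

lemma sum_ev:
  assumes "supported L"
  shows "(\<Sum>v\<in>V. ev L v) = (2 * int r + int \<mu> + 2) * height L"
  using assms
proof (induction L)
  case (Cons p L)
  obtain c X where p: "p = (c, X)" by (cases p)
  have "(\<Sum>v\<in>V. ev (p # L) v) = c * (\<Sum>v\<in>V. gram_row v X) + (\<Sum>v\<in>V. ev L v)"
    by (simp add: ev_def p sum.distrib sum_distrib_left)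
  then show ?case
    using Cons by (simp add: supported_def p sum_gram_row height_def algebra_simps)
qed (simp_all add: ev_def height_def)

lemma sum_gram_row_ev:
  assumes "supported L" "X \<subseteq> V"
  shows "(\<Sum>v\<in>V. gram_row v X * ev L v) = (int r + 2) * (\<Sum>(d, Y)\<leftarrow>L. d * gram_sum X Y) + int \<mu> * int (card X) * height L"
  using assms
proof (induction L)
  case (Cons p L)
  obtain d Y where p: "p = (d, Y)" by (cases p)
  have "(\<Sum>v\<in>V. gram_row v X * ev (p # L) v) = d * (\<Sum>v\<in>V. gram_row v X * gram_row v Y) + (\<Sum>v\<in>V. gram_row v X * ev L v)"
    by (simp add: ev_def p sum.distrib sum_distrib_left algebra_simps)
  then show ?case
    using Cons by (simp add: supported_def p sum_gram_row_gram_row height_def algebra_simps)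
qed (simp_all add: ev_def height_def)

lemma sum_ev_ev:
  assumes "supported L" "supported L'"
  shows "(\<Sum>v\<in>V. ev L v * ev L' v) =
    (int r + 2) * (\<Sum>(c, X)\<leftarrow>L. \<Sum>(d, Y)\<leftarrow>L'. c * d * gram_sum X Y) + int \<mu> * height L * height L'"
  using assms
proof (induction L)
  case (Cons p L)
  obtain c X where p: "p = (c, X)" by (cases p)
  have inner: "(\<Sum>(d, Y)\<leftarrow>L'. c * d * gram_sum X Y) = c * (\<Sum>(d, Y)\<leftarrow>L'. d * gram_sum X Y)"
    by (simp add: sum_list_const_mult[symmetric] case_prod_unfold mult.assoc)
  have step: "(\<Sum>v\<in>V. ev (p # L) v * ev L' v) = c * (\<Sum>v\<in>V. gram_row v X * ev L' v) + (\<Sum>v\<in>V. ev L v * ev L' v)"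
    by (simp add: ev_def p sum.distrib sum_distrib_left algebra_simps)
  have form: "(\<Sum>(c, X)\<leftarrow>p # L. \<Sum>(d, Y)\<leftarrow>L'. c * d * gram_sum X Y) =
      c * (\<Sum>(d, Y)\<leftarrow>L'. d * gram_sum X Y) + (\<Sum>(c, X)\<leftarrow>L. \<Sum>(d, Y)\<leftarrow>L'. c * d * gram_sum X Y)"
    by (simp add: p inner)
  have ht: "height (p # L) = c * int (card X) + height L"
    by (simp add: p height_def)
  have "X \<subseteq> V" "supported L" using Cons.prems by (auto simp: supported_def p)
  then show ?case
    unfolding step form ht sum_gram_row_ev[OF Cons.prems(2) \<open>X \<subseteq> V\<close>] Cons.IH[OF \<open>supported L\<close> Cons.prems(2)]
    by (simp add: distrib_left distrib_right mult_ac)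
qed (simp_all add: ev_def height_def)

lemma sum_ev_sq:
  "supported L \<Longrightarrow> (\<Sum>v\<in>V. (ev L v)\<^sup>2) = (int r + 2) * form L + int \<mu> * (height L)\<^sup>2"
  using sum_ev_ev[of L L] by (simp add: form_def power2_eq_square)

text \<open>For the all-one vector \<open>j\<close>, \<open>M j = (k + 2) j\<close> with
  \<open>k = 2r + \<mu>\<close>. Comparing \<open>(k + 2)^2\<close> with
  \<open>(r + 2) (k + 2) + \<mu> |V|\<close>, two values of an entry of \<open>M^2 j\<close>, gives
  the vertex count without division.\<close>

lemma card_V:
  assumes "V \<noteq> {}"
  shows "int \<mu> * int (card V) = (2 * int r + int \<mu> + 2) * (int r + int \<mu>)"
proof -
  obtain x where x: "x \<in> V" using assms by blast
  have row: "gram_row v V = 2 * int r + int \<mu> + 2" if "v \<in> V" for v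
    using sum_gram[OF that] by (simp add: gram_row_def gram_commute)
  have "(\<Sum>v\<in>V. gram_row v {x} * gram_row v V) = (2 * int r + int \<mu> + 2) * (\<Sum>v\<in>V. gram_row v {x})"
    by (subst sum_distrib_left, intro sum.cong) (simp_all add: row)
  moreover have "(\<Sum>v\<in>V. gram_row v {x}) = 2 * int r + int \<mu> + 2"
    using x by (simp add: sum_gram)
  moreover have "(\<Sum>v\<in>V. gram_row v {x} * gram_row v V) =
     (int r + 2) * (2 * int r + int \<mu> + 2) + int \<mu> * int (card V)"
    using sum_gram_row_gram_row[of "{x}" V] x by (simp add: gram_sum_singleton_left row)
  ultimately show ?thesis by (simp add: algebra_simps)
qed

text \<open>No eigenvectors are involved: Cauchy--Schwarz bounds the sum of squares of the inner
  products below by \<open>(k + 2)^2 h^2 / |V|\<close>, where \<open>h\<close> is the height, and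
  \<open>card_V\<close> gives \<open>\<mu> |V| \<le> (k + 2)^2\<close>, so the term
  \<open>\<mu> h^2\<close> cannot exceed this bound.\<close>

lemma form_nonneg:
  assumes "supported L"
  shows "form L \<ge> 0"
proof (cases "V = {}")
  case True
  then have "(int r + 2) * form L + int \<mu> * (height L)\<^sup>2 = 0"
    using sum_ev_sq[OF assms] by simp
  moreover have "c * int (card X) = 0" if "(c, X) \<in> set L" for c X
  proof -
    have "X \<subseteq> V" using assms that by (auto simp: supported_def)
    then show ?thesis using True by simp
  qed
  then have "map (\<lambda>(c, X). c * int (card X)) L = map (\<lambda>_. 0) L"
    by auto
  then have "height L = sum_list (map (\<lambda>_. 0) L)"
    unfolding height_def by (rule arg_cong)
  then have "height L = 0" by simp
  ultimately show ?thesis by simp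
next
  case False
  define k2 where "k2 = 2 * int r + int \<mu> + 2"
  define n where "n = int (card V)"
  have "n > 0" using False finite_V by (auto simp: n_def card_gt_0_iff)
  have mn: "int \<mu> * n \<le> k2\<^sup>2"
    unfolding n_def card_V[OF False] k2_def power2_eq_square by (intro mult_left_mono) auto
  have "(k2 * height L)\<^sup>2 \<le> n * (\<Sum>v\<in>V. (ev L v)\<^sup>2)"
    using sum_sq_le_card_mult[of "ev L" V] sum_ev[OF assms]
    by (simp add: n_def k2_def mult.commute)
  then have "k2\<^sup>2 * (height L)\<^sup>2 \<le> n * ((int r + 2) * form L + int \<mu> * (height L)\<^sup>2)"
    by (simp add: sum_ev_sq[OF assms] power_mult_distrib)
  moreover have "int \<mu> * n * (height L)\<^sup>2 \<le> k2\<^sup>2 * (height L)\<^sup>2"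
    using mn by (intro mult_right_mono) auto
  ultimately have "0 \<le> n * ((int r + 2) * form L)"
    by (simp add: algebra_simps)
  then show ?thesis using \<open>n > 0\<close> by (simp add: zero_le_mult_iff)
qed

lemma ev_eq_0:
  assumes "supported L" "height L = 0" "form L = 0" "v \<in> V"
  shows "ev L v = 0"
proof -
  have "(\<Sum>v\<in>V. (ev L v)\<^sup>2) = 0" using sum_ev_sq[OF assms(1)] assms(2,3) by simp
  then have "\<forall>v\<in>V. (ev L v)\<^sup>2 = 0"
    using finite_V by (subst (asm) sum_nonneg_eq_0_iff) auto
  then show ?thesis using assms(4) by simp
qed

lemma sum_ev_sq_minus_ev:
  assumes "supported L" "height L = 1" "form L = 2"
  shows "(\<Sum>v\<in>V. ev L v * (ev L v - 1)) = 2"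
proof -
  have "(\<Sum>v\<in>V. ev L v * (ev L v - 1)) = (\<Sum>v\<in>V. (ev L v)\<^sup>2) - (\<Sum>v\<in>V. ev L v)"
    by (simp add: sum_subtractf algebra_simps power2_eq_square)
  then show ?thesis using sum_ev_sq[OF assms(1)] sum_ev[OF assms(1)] assms(2,3) by simp
qed

lemma int_mult_pred_nonneg: "(i :: int) * (i - 1) \<ge> 0"
  by (cases "i \<ge> 1") (auto simp: mult_nonpos_nonpos)

lemma ev_01:
  assumes "supported L" "height L = 1" "form L = 2"
    and "w \<in> V" "ev L w * (ev L w - 1) \<ge> 2" "v \<in> V" "v \<noteq> w"
  shows "ev L v = 0 \<or> ev L v = 1"
proof -
  have "(\<Sum>v\<in>V. ev L v * (ev L v - 1)) =
      ev L w * (ev L w - 1) + (ev L v * (ev L v - 1) + (\<Sum>v\<in>V-{w}-{v}. ev L v * (ev L v - 1)))"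
    using assms(4,6,7) finite_V by (simp add: sum.remove[of V w] sum.remove[of "V-{w}" v])
  moreover have "(\<Sum>v\<in>V-{w}-{v}. ev L v * (ev L v - 1)) \<ge> 0"
    by (intro sum_nonneg int_mult_pred_nonneg)
  ultimately have "ev L v * (ev L v - 1) \<le> 0"
    using assms(5) sum_ev_sq_minus_ev[OF assms(1-3)] by simp
  then have "ev L v * (ev L v - 1) = 0" using int_mult_pred_nonneg[of "ev L v"] by linarith
  then show ?thesis by simp
qed

lemma ev_exceptional:
  assumes "supported L" "height L = 1" "form L = 2"
  obtains w where "w \<in> V" "ev L w \<noteq> 0" "ev L w \<noteq> 1"
proof -
  have "\<exists>w\<in>V. ev L w * (ev L w - 1) \<noteq> 0"
  proof (rule ccontr)
    assume "\<not> ?thesis"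
    then have "(\<Sum>v\<in>V. ev L v * (ev L v - 1)) = 0" by (intro sum.neutral) blast
    then show False using sum_ev_sq_minus_ev[OF assms] by simp
  qed
  then show ?thesis using that by auto
qed

lemmas vec_simps = supported_def height_def form_def ev_def gram_sum_singleton_left

text \<open>The vector \<open>x + y - z - w\<close> has height 0 and norm \<open>8 - 8 = 0\<close>,
  so the two diagonals of an induced 4-cycle have equal sums. Testing this relation against a
  further vertex \<open>u\<close> is the recurring step below.\<close>

lemma four_cycle:
  assumes "adj x z" "adj x w" "adj y z" "adj y w" "x \<noteq> y" "z \<noteq> w" "\<not> adj x y" "\<not> adj z w" "u \<in> V"
  shows "gram u x + gram u y = gram u z + gram u w"
proof -
  define L where "L = [(1, {x}), (1, {y}), (-1, {z}), (-1 :: int, {w})]"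
  have V: "x \<in> V" "y \<in> V" "z \<in> V" "w \<in> V" using assms adj_V adj_V2 by blast+
  have g: "gram x y = 0" "gram y x = 0" "gram z w = 0" "gram w z = 0"
    "gram x z = 1" "gram z x = 1" "gram x w = 1" "gram w x = 1"
    "gram y z = 1" "gram z y = 1" "gram y w = 1" "gram w y = 1"
    using assms by (simp_all add: gram_adj gram_nonadj gram_adj' gram_nonadj')
  have "ev L u = 0"
    using V assms(9) by (intro ev_eq_0) (simp_all add: L_def vec_simps g)
  then show ?thesis by (simp add: L_def vec_simps)
qed

end

section \<open>Claws\<close>

context srg_neg2 begin

text \<open>The neighbourhood of \<open>x\<close> in the complement of the graph induced on
  \<open>nbh z\<close>; for adjacent \<open>z\<close> and \<open>x\<close> its size is
  \<open>k - \<lambda> - 1 = r + 1\<close>.\<close>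

definition co_nbh :: "'a \<Rightarrow> 'a \<Rightarrow> 'a set" where
  "co_nbh z x = {w \<in> nbh z. w \<noteq> x \<and> \<not> adj x w}"

lemma finite_co_nbh [simp]: "finite (co_nbh z x)"
  by (simp add: co_nbh_def)

lemma card_co_nbh:
  assumes "adj z x"
  shows "card (co_nbh z x) = r + 1"
proof -
  have "nbh z = insert x (nbh z \<inter> nbh x \<union> co_nbh z x)"
    using assms by (auto simp: co_nbh_def)
  moreover have "x \<notin> nbh z \<inter> nbh x \<union> co_nbh z x" "nbh z \<inter> nbh x \<inter> co_nbh z x = {}"
    by (auto simp: co_nbh_def adj_irrefl)
  ultimately have "card (nbh z) = 1 + (card (nbh z \<inter> nbh x) + card (co_nbh z x))"
    by (metis (no_types, lifting) card_Un_disjoint card_insert_disjoint finite_Int finite_Un finite_co_nbh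
        finite_nbh plus_1_eq_Suc)
  then show ?thesis using degree[OF adj_V[OF assms]] common_adj[OF assms] by simp
qed

text \<open>The vector \<open>x + y - z\<close> has height 1, norm 2 and values 1, 1, 0 at
  \<open>x\<close>, \<open>y\<close>, \<open>z\<close>. So its exceptional vertex lies outside the
  path: the value -1 makes it the third leaf of a claw, the value 2 the fourth vertex of a
  4-cycle.\<close>

lemma path_exceptional:
  assumes "adj z x" "adj z y" "x \<noteq> y" "\<not> adj x y"
  obtains (claw) w where "adj z w" "w \<noteq> x" "w \<noteq> y" "\<not> adj x w" "\<not> adj y w"
    | (cycle) w where "adj x w" "adj y w" "w \<noteq> z" "\<not> adj z w"
proof -
  define L where "L = [(1, {x}), (1, {y}), (-1 :: int, {z})]"
  have V: "x \<in> V" "y \<in> V" "z \<in> V" using assms adj_V adj_V2 by blast+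
  have g: "gram x y = 0" "gram y x = 0" "gram x z = 1" "gram z x = 1" "gram y z = 1" "gram z y = 1"
    using assms by (simp_all add: gram_adj gram_nonadj gram_adj' gram_nonadj')
  have "supported L" "height L = 1" "form L = 2"
    using V by (simp_all add: L_def vec_simps g)
  then obtain w where w: "w \<in> V" "ev L w \<noteq> 0" "ev L w \<noteq> 1"
    using ev_exceptional by blast
  have ev: "ev L w = gram w x + gram w y - gram w z" by (simp add: L_def vec_simps)
  have "w \<noteq> x" "w \<noteq> y" "w \<noteq> z" using w ev g by auto
  then have "adj w z \<and> \<not> adj w x \<and> \<not> adj w y \<or> adj w x \<and> adj w y \<and> \<not> adj w z"
    using w(2,3) unfolding ev by (auto simp: gram_def split: if_splits)
  then show ?thesis using that \<open>w \<noteq> x\<close> \<open>w \<noteq> y\<close> \<open>w \<noteq> z\<close> adj_sym by blast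
qed

text \<open>The relation of the first 4-cycle, tested against \<open>w'\<close>, gives
  \<open>w'\<close> and \<open>w\<close> inner product 2.\<close>

lemma cycle_unique:
  assumes "adj z x" "adj z y" "x \<noteq> y" "\<not> adj x y"
    and "adj x w" "adj y w" "w \<noteq> z" "\<not> adj z w"
    and "adj x w'" "adj y w'" "w' \<noteq> z" "\<not> adj z w'"
  shows "w' = w"
proof (rule ccontr)
  assume "w' \<noteq> w"
  have "w' \<in> V" using assms adj_V2 by blast
  have "gram w' x + gram w' y = gram w' z + gram w' w"
    using assms \<open>w' \<in> V\<close> adj_sym by (intro four_cycle) (auto simp: adj_commute)
  moreover have "gram w' x = 1" "gram w' y = 1" "gram w' z = 0"
    using assms by (simp_all add: gram_adj' gram_nonadj')
  ultimately have "gram w' w = 2" by simp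
  then show False using \<open>w' \<noteq> w\<close> by (simp add: gram_def split: if_splits)
qed

definition claw :: "'a \<Rightarrow> 'a \<Rightarrow> 'a \<Rightarrow> 'a \<Rightarrow> bool" where
  "claw z x y u \<longleftrightarrow> adj z x \<and> adj z y \<and> adj z u \<and> x \<noteq> y \<and> x \<noteq> u \<and> y \<noteq> u \<and>
     \<not> adj x y \<and> \<not> adj x u \<and> \<not> adj y u"

lemma claw_gram:
  assumes "claw z x y u"
  shows "x \<in> V" "y \<in> V" "u \<in> V" "z \<in> V"
    "gram x y = 0" "gram y x = 0" "gram x u = 0" "gram u x = 0" "gram y u = 0" "gram u y = 0"
    "gram x z = 1" "gram z x = 1" "gram y z = 1" "gram z y = 1" "gram u z = 1" "gram z u = 1"
  using assms adj_V adj_V2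
  by (auto simp add: claw_def gram_adj gram_nonadj gram_adj' gram_nonadj')

text \<open>The vector \<open>x + y + u - 2z\<close> has height 1 and norm
  \<open>6 + 8 - 12 = 2\<close>, and its exceptional vertex is \<open>z\<close>, with value
  -1.\<close>

lemma claw_01:
  assumes "claw z x y u" "v \<in> V" "v \<noteq> z"
  shows "gram v x + gram v y + gram v u - 2 * gram v z \<in> {0, 1}"
proof -
  note g = claw_gram[OF assms(1)]
  define L where "L = [(1, {x}), (1, {y}), (1, {u}), (-2 :: int, {z})]"
  have L: "supported L" "height L = 1" "form L = 2"
    using g by (simp_all add: L_def vec_simps)
  have "ev L z = -1" using g by (simp add: L_def vec_simps)
  then have "ev L v = 0 \<or> ev L v = 1"
    using g assms by (intro ev_01[OF L, of z]) auto
  then show ?thesis by (auto simp: L_def vec_simps)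
qed

text \<open>By \<open>claw_01\<close> only 2 and 3 are possible. For \<open>v\<close> outside the
  claw, the value 3 would give \<open>x + y + u - z - v\<close> height 1 and norm 0; its inner
  products would have sum of squares \<open>\<mu>\<close>, less than their sum
  \<open>2r + \<mu> + 2\<close>, which integers do not allow.\<close>

lemma claw_nbh:
  assumes "claw z x y u" "adj z v"
  shows "gram v x + gram v y + gram v u = 2"
proof (cases "v \<in> {x, y, u}")
  case True
  then show ?thesis using claw_gram[OF assms(1)] by auto
next
  case False
  note g = claw_gram[OF assms(1)]
  have v: "v \<in> V" "v \<noteq> z" "gram v z = 1" "gram z v = 1"
    using assms(2) adj_V2 adj_neq by (auto simp: gram_adj gram_adj')
  have "gram v x + gram v y + gram v u \<noteq> 3"
  proof
    assume 3: "gram v x + gram v y + gram v u = 3"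
    have "gram v x = 1" "gram v y = 1" "gram v u = 1"
      using 3 False by (auto simp: gram_def split: if_splits)
    then have gv: "gram v x = 1" "gram v y = 1" "gram v u = 1" "gram x v = 1" "gram y v = 1" "gram u v = 1"
      by (simp_all add: gram_commute)
    define L where "L = [(1, {x}), (1, {y}), (1, {u}), (-1 :: int, {z}), (-1, {v})]"
    have L: "supported L" "height L = 1" "form L = 0"
      using g v by (simp_all add: L_def vec_simps gv)
    have "(\<Sum>w\<in>V. ev L w * (ev L w - 1)) = (\<Sum>w\<in>V. (ev L w)\<^sup>2) - (\<Sum>w\<in>V. ev L w)"
      by (simp add: sum_subtractf algebra_simps power2_eq_square)
    also have "\<dots> < 0" using sum_ev_sq[OF L(1)] sum_ev[OF L(1)] L by simp
    finally show False using sum_nonneg[of V "\<lambda>w. ev L w * (ev L w - 1)"] int_mult_pred_nonneg by force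
  qed
  then show ?thesis using claw_01[OF assms(1) v(1,2)] v(3) by auto
qed

lemma sum_gram_nbh:
  assumes "adj z x"
  shows "(\<Sum>v\<in>nbh z. gram v x) = int r + int \<mu>"
proof -
  have "(\<Sum>v\<in>nbh z. (of_bool (adj x v) :: int)) = int (card (nbh z \<inter> nbh x))"
    by (simp add: sum_of_bool_eq)
  moreover have "(\<Sum>v\<in>nbh z. (of_bool (v = x) :: int)) = 1"
    using assms by simp
  ultimately show ?thesis
    using common_adj[OF assms] by (simp add: gram_of_bool sum.distrib flip: sum_distrib_left)
qed

text \<open>Summing \<open>claw_nbh\<close> over \<open>nbh z\<close> gives
  \<open>3 (\<lambda> + 2) = 2k\<close>.\<close>

lemma claw_mu:
  assumes "claw z x y u"
  shows "\<mu> = r"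
proof -
  have a: "adj z x" "adj z y" "adj z u" using assms by (auto simp: claw_def)
  have "3 * (int r + int \<mu>) = (\<Sum>v\<in>nbh z. gram v x + gram v y + gram v u)"
    by (simp add: sum.distrib sum_gram_nbh a)
  also have "\<dots> = (\<Sum>v\<in>nbh z. 2)"
    using claw_nbh[OF assms] by (intro sum.cong) auto
  also have "\<dots> = 2 * (2 * int r + int \<mu>)"
    using degree[OF adj_V[OF a(1)]] by simp
  finally show ?thesis by simp
qed

text \<open>The inner products of \<open>x + y + u - z\<close> with the vertices are at most 1, and their sum is the
  number of vertices.\<close>

lemma claw_all_one:
  assumes "claw z x y u" "v \<in> V"
  shows "gram v x + gram v y + gram v u - gram v z = 1"
proof -
  note g = claw_gram[OF assms(1)]
  define f where "f v = 1 - (gram v x + gram v y + gram v u - gram v z)" for v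
  have "f w \<ge> 0" if "w \<in> V" for w
  proof -
    consider "w = z" | "adj z w" | "w \<noteq> z" "\<not> adj z w" by blast
    then show ?thesis
    proof cases
      case 1
      then show ?thesis using g by (simp add: f_def)
    next
      case 2
      then show ?thesis using claw_nbh[OF assms(1) 2] by (simp add: f_def gram_adj')
    next
      case 3
      then show ?thesis using claw_01[OF assms(1) that 3(1)] by (auto simp: f_def gram_nonadj')
    qed
  qed
  moreover have "(\<Sum>v\<in>V. f v) = 0"
  proof -
    have "int r * int (card V) = int r * (2 * (3 * int r + 2))"
      using card_V claw_mu[OF assms(1)] g(1) by (force simp: algebra_simps)
    then have "int (card V) = 2 * (3 * int r + 2)"
      using mu_pos claw_mu[OF assms(1)] by simp
    then show ?thesis
      using claw_mu[OF assms(1)] by (simp add: f_def sum.distrib sum_subtractf sum_gram g)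
  qed
  ultimately have "f v = 0" using assms(2) finite_V by (simp add: sum_nonneg_eq_0_iff)
  then show ?thesis by (simp add: f_def)
qed

text \<open>The vector \<open>x + y + u - z\<close> has inner product 1 with each of
  \<open>p\<close>, \<open>q\<close>, \<open>s\<close>, hence 3 with their sum, while by assumption
  each of its four terms contributes an even number.\<close>

lemma claw_no_even_triangle:
  assumes "claw z x y u" "p \<in> V" "q \<in> V" "s \<in> V"
    and "\<And>w. w \<in> V \<Longrightarrow> even (gram w p + gram w q + gram w s)"
  shows False
proof -
  have 3: "(gram x p + gram x q + gram x s) + (gram y p + gram y q + gram y s)
      + (gram u p + gram u q + gram u s) - (gram z p + gram z q + gram z s) = 3"
    using claw_all_one[OF assms(1), of p] claw_all_one[OF assms(1), of q] claw_all_one[OF assms(1), of s] assms(2-4)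
    by (simp add: gram_commute)
  have e: "even (gram x p + gram x q + gram x s)" "even (gram y p + gram y q + gram y s)"
      "even (gram u p + gram u q + gram u s)" "even (gram z p + gram z q + gram z s)"
    using assms(5) claw_gram[OF assms(1)] by blast+
  have "even (3 :: int)"
    unfolding 3[symmetric] by (rule dvd_diff[OF dvd_add[OF dvd_add[OF e(1,2)] e(3)] e(4)])
  then show False by simp
qed

lemma gram_sum_clique:
  assumes "\<And>w w'. w \<in> T \<Longrightarrow> w' \<in> T \<Longrightarrow> w \<noteq> w' \<Longrightarrow> adj w w'" "finite T"
  shows "gram_sum T T = int (card T) * (int (card T) + 1)"
proof -
  have "gram_row w T = int (card T) + 1" if "w \<in> T" for w
  proof -
    have "gram_row w T = 2 + (\<Sum>w'\<in>T-{w}. gram w w')"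
      using that assms(2) by (simp add: gram_row_def sum.remove)
    also have "\<dots> = 2 + (\<Sum>w'\<in>T-{w}. 1)"
      using assms(1) that by (intro arg_cong2[where f="(+)"] sum.cong) (auto simp: gram_adj)
    also have "\<dots> = int (card T) + 1"
      using card.remove[OF assms(2) that] by (simp del: card_Diff_insert)
    finally show ?thesis .
  qed
  then show ?thesis by (simp add: gram_sum_def)
qed

text \<open>The vectors \<open>2w - (x + 2y + u - 2z)\<close> for \<open>w \<in> T1\<close> and \<open>x + u - 2w\<close> for \<open>w \<in> T2\<close> are pairwise
  orthogonal of norm 4 and have inner product 2 with the norm 4 vector \<open>2v - (2x + y + u - 2z)\<close>;
  as there are \<open>r\<close> of them, Bessel's inequality bounds \<open>r\<close>.\<close>

lemma claw_r_le_4: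
  assumes claw: "claw z x y u"
  shows "r \<le> 4"
proof -
  note g = claw_gram[OF claw] and mu = claw_mu[OF claw] and one = claw_all_one[OF claw]
  have c: "adj z x" "adj z y" "adj z u" "x \<noteq> y" "x \<noteq> u" "y \<noteq> u" "\<not> adj x y" "\<not> adj x u" "\<not> adj y u"
    using claw by (auto simp: claw_def)
  have "co_nbh x z \<noteq> {}" using card_co_nbh[OF adj_sym[OF c(1)]] by auto
  then obtain v where v: "adj x v" "v \<noteq> z" "\<not> adj z v" by (auto simp: co_nbh_def)
  have vV: "v \<in> V" using v adj_V2 by blast
  have gv: "gram v x = 1" "gram x v = 1" "gram v z = 0" "gram z v = 0"
    using v by (simp_all add: gram_adj gram_adj' gram_nonadj gram_nonadj')
  have nn: "gram a b \<ge> 0" for a b by (simp add: gram_def)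
  have "gram v y = 0" "gram v u = 0"
    using one[OF vV] gv nn[of v y] nn[of v u] by linarith+
  then have gv2: "gram v y = 0" "gram y v = 0" "gram v u = 0" "gram u v = 0"
    by (simp_all add: gram_commute)
  then have nv: "\<not> adj v y" "v \<noteq> y" "\<not> adj v u" "v \<noteq> u"
    by (auto simp: gram_def split: if_splits)
  define T1 where "T1 = {w. adj v w \<and> adj y w \<and> \<not> adj z w}"
  define T2 where "T2 = {w \<in> co_nbh z y. w \<noteq> u \<and> \<not> adj v w}"
  have T1V: "T1 \<subseteq> V" "finite T1" and T2V: "T2 \<subseteq> V" "finite T2"
    using nbh_subset finite_subset[OF _ finite_V] by (auto simp: T1_def T2_def co_nbh_def intro: adj_V2 finite_sub)
  have T1: "gram w v = 1" "gram w y = 1" "gram w z = 0" "gram w x = 0" "gram w u = 0" "w \<noteq> z" if "w \<in> T1" for w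
  proof -
    show 1: "gram w v = 1" "gram w y = 1" "w \<noteq> z" using that v by (auto simp: T1_def gram_adj' adj_commute)
    show 2: "gram w z = 0" using that 1 by (auto simp: T1_def gram_nonadj')
    show "gram w x = 0" "gram w u = 0"
      using one[of w] that T1V 1 2 nn[of w x] nn[of w u] by force+
  qed
  have T2: "gram w v = 0" "gram w y = 0" "gram w z = 1" "gram w x = 1" "gram w u = 1" "w \<noteq> x" if "w \<in> T2" for w
  proof -
    show 1: "gram w y = 0" "gram w z = 1" "w \<noteq> x" using that v by (auto simp: T2_def co_nbh_def gram_adj' gram_nonadj' adj_commute)
    have "w \<noteq> v" using that v by (auto simp: T2_def co_nbh_def)
    then show 2: "gram w v = 0" using that by (auto simp: T2_def gram_nonadj')
    have "gram w x + gram w u = 2" using one[of w] that T2V 1 by force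
    moreover have "gram w u \<le> 1" "gram w x \<le> 1" using that 1 by (auto simp: gram_def T2_def)
    ultimately show "gram w x = 1" "gram w u = 1" by linarith+
  qed
  have adjT1: "adj w v" "adj w y" "\<not> adj w z" "\<not> adj w x" "\<not> adj w u" if "w \<in> T1" for w
    using T1[OF that] that v by (auto simp: gram_def split: if_splits)
  have adjT2: "adj w x" "adj w u" "adj w z" "\<not> adj w y" "\<not> adj w v" "w \<noteq> y" if "w \<in> T2" for w
    using T2[OF that] that by (auto simp: gram_def split: if_splits)
  \<comment> \<open>In this and the next two facts, a wrong adjacency would create an induced
    4-cycle whose relation fails at a vertex with known inner products: at \<open>x\<close> for
    \<open>T1\<close>, at \<open>v\<close> in the other two.\<close>
  have clq1: "adj w w'" if "w \<in> T1" "w' \<in> T1" "w \<noteq> w'" for w w'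
  proof (rule ccontr)
    assume n: "\<not> adj w w'"
    have "gram x y + gram x v = gram x w + gram x w'"
      by (rule four_cycle; use n that adjT1 g nv in \<open>blast intro: adj_sym\<close>)
    then show False using T1[OF that(1)] T1[OF that(2)] g gv by (simp add: gram_commute)
  qed
  have clq2: "adj w w'" if "w \<in> T2" "w' \<in> T2" "w \<noteq> w'" for w w'
  proof (rule ccontr)
    assume n: "\<not> adj w w'"
    have "gram v x + gram v u = gram v w + gram v w'"
      by (rule four_cycle; use n that adjT2 vV c in \<open>blast intro: adj_sym\<close>)
    then show False using T2[OF that(1)] T2[OF that(2)] gv gv2 by (simp add: gram_commute)
  qed
  have cross: "gram w w' = 0" if "w \<in> T1" "w' \<in> T2" for w w'
  proof (rule ccontr)
    assume "gram w w' \<noteq> 0"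
    moreover have "w \<noteq> w'" using T1[OF that(1)] T2[OF that(2)] by auto
    ultimately have n: "adj w w'" by (auto simp: gram_def split: if_splits)
    have "gram v z + gram v w = gram v w' + gram v y"
      by (rule four_cycle; use n that adjT1[OF that(1)] adjT2[OF that(2)] vV c T1(6)[OF that(1)] in \<open>blast intro: adj_sym\<close>)
    then show False using T1[OF that(1)] T2[OF that(2)] gv gv2 by (simp add: gram_commute)
  qed
  define t1 t2 where "t1 = int (card T1)" and "t2 = int (card T2)"
  \<comment> \<open>\<open>T1\<close> and \<open>nbh v \<inter> co_nbh z y\<close> have equal size,
    each being what is left of \<open>\<mu>\<close> without the common neighbours of
    \<open>v\<close>, \<open>y\<close>, \<open>z\<close>. The latter set, \<open>T2\<close> and
    \<open>u\<close> make up the \<open>r + 1\<close> elements of \<open>co_nbh z y\<close>.\<close>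
  have "card T1 + card T2 = r"
  proof -
    have a: "nbh v \<inter> nbh y = T1 \<union> nbh v \<inter> nbh y \<inter> nbh z" "T1 \<inter> (nbh v \<inter> nbh y \<inter> nbh z) = {}"
      by (auto simp: T1_def)
    have b: "nbh v \<inter> nbh z = nbh v \<inter> nbh y \<inter> nbh z \<union> nbh v \<inter> co_nbh z y"
      "nbh v \<inter> nbh y \<inter> nbh z \<inter> (nbh v \<inter> co_nbh z y) = {}"
      using nv by (auto simp: co_nbh_def)
    have d: "co_nbh z y = insert u (T2 \<union> nbh v \<inter> co_nbh z y)" "u \<notin> T2 \<union> nbh v \<inter> co_nbh z y"
      "T2 \<inter> (nbh v \<inter> co_nbh z y) = {}"
      using nv c by (auto simp: co_nbh_def T2_def adj_commute)
    have a': "card (nbh v \<inter> nbh y) = card T1 + card (nbh v \<inter> nbh y \<inter> nbh z)"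
      using card_Un_disjoint[of T1 "nbh v \<inter> nbh y \<inter> nbh z"] a T1V by simp
    have b': "card (nbh v \<inter> nbh z) = card (nbh v \<inter> nbh y \<inter> nbh z) + card (nbh v \<inter> co_nbh z y)"
      using card_Un_disjoint[of "nbh v \<inter> nbh y \<inter> nbh z" "nbh v \<inter> co_nbh z y"] b by simp
    have "card (co_nbh z y) = Suc (card (T2 \<union> nbh v \<inter> co_nbh z y))"
      using d T2V by (metis (no_types, lifting) card_insert_disjoint finite_Int finite_Un finite_co_nbh)
    then have d': "card (co_nbh z y) = Suc (card T2 + card (nbh v \<inter> co_nbh z y))"
      using card_Un_disjoint[of T2 "nbh v \<inter> co_nbh z y"] d T2V by simp
    show ?thesis
      using a' b' d' card_co_nbh[OF c(2)] common_nonadj[of v y] common_nonadj[of v z] vV g nv v mu adj_commute[of v z]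
      by auto
  qed
  then have t: "t1 + t2 = int r" by (simp add: t1_def t2_def)
  \<comment> \<open>Twice the vector of \<open>v\<close> minus the sum of the \<open>r\<close>
    orthogonal vectors, that is, twice the Bessel remainder; its norm is
    \<open>4 * 4 - 4 * 2 * r + 4 * r = 16 - 4r\<close>.\<close>
  define L where "L = [(4, {v}), (-4 + t1 - t2, {x}), (-2 + 2 * t1, {y}), (-2 + t1 - t2, {u}),
    (4 - 2 * t1, {z}), (-2, T1), (2, T2)]"
  have gs: "gram_row v T1 = t1" "gram_row v T2 = 0" "gram_row x T1 = 0" "gram_row x T2 = t2" "gram_row y T1 = t1" "gram_row y T2 = 0"
      "gram_row u T1 = 0" "gram_row u T2 = t2" "gram_row z T1 = 0" "gram_row z T2 = t2"
    using T1 T2 by (simp_all add: gram_row_def t1_def t2_def gram_commute[of v] gram_commute[of x]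
        gram_commute[of y] gram_commute[of z] gram_commute[of u])
  have gT: "gram_sum T1 T1 = t1 * (t1 + 1)" "gram_sum T2 T2 = t2 * (t2 + 1)" "gram_sum T1 T2 = 0" "gram_sum T2 T1 = 0"
    using gram_sum_clique[of T1] gram_sum_clique[of T2] clq1 clq2 cross T1V T2V gram_sum_commute[of T2 T1]
    by (auto simp: t1_def t2_def gram_sum_def gram_row_def)
  have "form L \<ge> 0"
    using g T1V T2V vV by (intro form_nonneg) (simp add: supported_def L_def)
  moreover have "form L = 16 - 4 * (t1 + t2)"
    by (simp add: L_def form_def gram_sum_singleton_left gram_sum_singleton_right g gv gv2 gs gT algebra_simps)
  ultimately show ?thesis using t by simp
qed

end

section \<open>Claw-free graphs\<close>

context srg_neg2 begin

lemma co_nbh_commute: "adj z x \<Longrightarrow> adj z y \<Longrightarrow> y \<in> co_nbh z x \<longleftrightarrow> x \<in> co_nbh z y"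
  by (auto simp: co_nbh_def dest: adj_sym)

text \<open>Inclusion-exclusion inside \<open>nbh z\<close>, with
  \<open>2 \<lambda> - k = \<mu> - 4\<close>. Being adjacent, \<open>x\<close> and \<open>u\<close>
  are themselves covered by the two neighbourhoods.\<close>

lemma triangle_count:
  assumes "adj z x" "adj z u" "adj x u"
  shows "card (nbh z \<inter> nbh x \<inter> nbh u) + 4 = \<mu> + card (co_nbh z x \<inter> co_nbh z u)"
proof -
  let ?X = "nbh z \<inter> nbh x" and ?U = "nbh z \<inter> nbh u" and ?H = "co_nbh z x \<inter> co_nbh z u"
  have "nbh z = (?X \<union> ?U) \<union> ?H" "(?X \<union> ?U) \<inter> ?H = {}"
    using assms by (auto simp: co_nbh_def dest: adj_sym)
  then have "card (nbh z) = card (?X \<union> ?U) + card ?H"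
    by (metis card_Un_disjoint finite_Int finite_Un finite_co_nbh finite_nbh)
  moreover have "card ?X + card ?U = card (?X \<union> ?U) + card (nbh z \<inter> nbh x \<inter> nbh u)"
    using card_Un_Int[of ?X ?U] by (simp add: Int_ac)
  ultimately show ?thesis
    using degree[OF adj_V[OF assms(1)]] common_adj[OF assms(1)] common_adj[OF assms(2)] by simp
qed

end

locale srg_no_claw = srg_neg2 +
  assumes no_claw: "\<not> claw z x y u"
begin

lemma antipode:
  assumes "adj z x" "adj z y" "x \<noteq> y" "\<not> adj x y"
  obtains w where "adj x w" "adj y w" "w \<noteq> z" "\<not> adj z w"
  using assms
proof (cases rule: path_exceptional)
  case (claw w)
  then have "claw z x y w" using assms by (auto simp: claw_def)
  then show ?thesis using no_claw by blast
qed (use that in blast)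

lemma co_nbh_clique:
  assumes "adj z x" "y \<in> co_nbh z x" "y' \<in> co_nbh z x" "y \<noteq> y'"
  shows "adj y y'"
  using no_claw[of z x y y'] assms by (auto simp: claw_def co_nbh_def)

lemma co_nbh_adj:
  assumes "adj z x" "y \<in> co_nbh z x" "w \<in> nbh z" "w \<noteq> x" "w \<noteq> y" "\<not> adj x w"
  shows "adj y w"
  using assms by (intro co_nbh_clique[OF assms(1,2)]) (auto simp: co_nbh_def)

text \<open>For non-adjacent \<open>x\<close> and \<open>y\<close>, this is their common neighbourhood without \<open>z\<close> and its antipode.\<close>

definition common :: "'a \<Rightarrow> 'a \<Rightarrow> 'a \<Rightarrow> 'a set" where
  "common z x y = nbh z \<inter> nbh x \<inter> nbh y"

lemma card_common:
  assumes "adj z x" "y \<in> co_nbh z x"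
  shows "card (common z x y) + 2 = \<mu>"
proof -
  have y: "adj z y" "x \<noteq> y" "\<not> adj x y" using assms by (auto simp: co_nbh_def)
  obtain w where w: "adj x w" "adj y w" "w \<noteq> z" "\<not> adj z w"
    by (rule antipode[OF assms(1) y])
  have "nbh x \<inter> nbh y = insert z (insert w (common z x y))"
  proof (intro Set.set_eqI iffI)
    fix v assume "v \<in> nbh x \<inter> nbh y"
    then show "v \<in> insert z (insert w (common z x y))"
      using cycle_unique[OF assms(1) y w, of v] by (auto simp: common_def)
  qed (use w assms(1) y(1) in \<open>auto simp: common_def dest: adj_sym\<close>)
  moreover have "z \<notin> insert w (common z x y)" "w \<notin> common z x y"
    using w by (auto simp: common_def adj_irrefl)
  ultimately have "card (nbh x \<inter> nbh y) = card (common z x y) + 2"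
    by (simp add: common_def)
  then show ?thesis using common_nonadj[of x y] y adj_V2 assms by auto
qed

text \<open>The fourth vertex \<open>q\<close> of the 4-cycle through \<open>x\<close>,
  \<open>p\<close>, \<open>y\<close> is adjacent to \<open>z\<close>: test
  \<open>x + y = p + q\<close> against \<open>z\<close>. Thus \<open>common z x y\<close> induces a
  cocktail party graph.\<close>

lemma partner:
  assumes "adj z x" "y \<in> co_nbh z x" "p \<in> common z x y"
  shows "\<exists>!q. q \<in> common z x y \<and> q \<noteq> p \<and> \<not> adj p q"
proof -
  have y: "adj z y" "x \<noteq> y" "\<not> adj x y" using assms by (auto simp: co_nbh_def)
  have p: "adj z p" "adj x p" "adj y p" using assms by (auto simp: common_def)
  obtain q where q: "adj x q" "adj y q" "q \<noteq> p" "\<not> adj p q"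
    by (rule antipode[OF adj_sym[OF p(2)] adj_sym[OF p(3)] y(2,3)])
  have "gram z x + gram z y = gram z p + gram z q"
    using p q y adj_V assms(1) by (intro four_cycle) auto
  then have "gram z q = 1" using assms(1) y p by (simp add: gram_adj)
  then have "adj z q" by (auto simp: gram_def split: if_splits)
  then have "q \<in> common z x y" using q by (auto simp: common_def)
  then have "q \<in> common z x y \<and> q \<noteq> p \<and> \<not> adj p q" using q by blast
  moreover have "q' = q" if "q' \<in> common z x y \<and> q' \<noteq> p \<and> \<not> adj p q'" for q'
    by (rule cycle_unique[OF adj_sym[OF p(2)] adj_sym[OF p(3)] y(2,3) q])
      (use that in \<open>simp_all add: common_def\<close>)
  ultimately show ?thesis by (rule ex1I)
qed

text \<open>The relation \<open>x + y = p + q\<close> is tested against \<open>u\<close>, which is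
  adjacent to \<open>x\<close> but not to \<open>y\<close>.\<close>

lemma partner_one:
  assumes "adj z x" "y \<in> co_nbh z x" "p \<in> common z x y" "q \<in> common z x y" "p \<noteq> q" "\<not> adj p q"
    and "u \<in> co_nbh z y" "u \<noteq> x"
  shows "adj u p \<longleftrightarrow> \<not> adj u q"
proof -
  have y: "adj z y" "x \<noteq> y" "\<not> adj x y" using assms by (auto simp: co_nbh_def)
  have u: "adj z u" "u \<noteq> y" "\<not> adj u y" "adj u x"
    using assms(7,8) co_nbh_adj[OF y(1) assms(7), of x] assms(1) y by (auto simp: co_nbh_def dest: adj_sym)
  have pq: "adj x p" "adj x q" "adj y p" "adj y q" using assms by (auto simp: common_def)
  have "gram u x + gram u y = gram u p + gram u q"
    using pq y adj_V2 u assms by (intro four_cycle) auto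
  then have "gram u p + gram u q = 1" using u by (simp add: gram_adj gram_nonadj)
  moreover have "u \<noteq> p" "u \<noteq> q" using pq u adj_sym by blast+
  ultimately show ?thesis by (auto simp: gram_def split: if_splits)
qed

text \<open>The pairing of \<open>common z x y\<close> by \<open>partner\<close> exchanges
  neighbours and non-neighbours of \<open>u\<close>, so these make up half of the
  \<open>\<mu> - 2\<close> elements each. In particular \<open>\<mu>\<close> is even.\<close>

lemma card_common_nonadj:
  assumes "adj z x" "y \<in> co_nbh z x" "u \<in> co_nbh z y" "u \<noteq> x"
  shows "2 * card {p \<in> common z x y. \<not> adj u p} + 2 = \<mu>"
proof -
  define star where "star p = (THE q. q \<in> common z x y \<and> q \<noteq> p \<and> \<not> adj p q)" for p
  have star: "star p \<in> common z x y" "star p \<noteq> p" "\<not> adj p (star p)" if "p \<in> common z x y" for p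
    using theI'[OF partner[OF assms(1,2) that]] by (auto simp: star_def)
  have inv: "star (star p) = p" if "p \<in> common z x y" for p
  proof -
    have "p \<in> common z x y \<and> p \<noteq> star p \<and> \<not> adj (star p) p"
      using star[OF that] that adj_commute by metis
    then show ?thesis
      using the1_equality[OF partner[OF assms(1,2) star(1)[OF that]]] unfolding star_def by blast
  qed
  have sw: "adj u p \<longleftrightarrow> \<not> adj u (star p)" if "p \<in> common z x y" for p
    using partner_one[OF assms(1,2) that star(1)[OF that] _ _ assms(3,4)] star[OF that] by metis
  let ?A = "{p \<in> common z x y. \<not> adj u p}" and ?B = "{p \<in> common z x y. adj u p}"
  have "star p \<in> ?B" if "p \<in> ?A" for p using that star(1)[of p] sw[of p] by blast
  moreover have "star p \<in> ?A" if "p \<in> ?B" for p using that star(1)[of p] sw[of p] by blast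
  ultimately have "bij_betw star ?A ?B"
    by (intro bij_betw_byWitness[where f'=star]) (simp_all add: inv image_subset_iff)
  then have "card ?A = card ?B" by (rule bij_betw_same_card)
  moreover have "common z x y = ?A \<union> ?B" "?A \<inter> ?B = {}" "finite (common z x y)"
    by (auto simp: common_def)
  then have "card (common z x y) = card ?A + card ?B"
    by (metis (no_types, lifting) card_Un_disjoint finite_Un)
  ultimately show ?thesis using card_common[OF assms(1,2)] by simp
qed

text \<open>An element of \<open>co_nbh z u\<close> other than \<open>y\<close> is adjacent to
  \<open>y\<close>, hence it lies in \<open>co_nbh z x\<close> or is one of the
  \<open>(\<mu> - 2) / 2\<close> elements of \<open>common z x y\<close> that miss \<open>u\<close>.
  So these intersections are empty or of the fixed size \<open>r + 2 - \<mu> / 2\<close>.\<close>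

lemma card_co_nbh_Int:
  assumes "adj z x" "adj z u" "adj x u" "y \<in> co_nbh z x" "y \<in> co_nbh z u"
  shows "2 * card (co_nbh z x \<inter> co_nbh z u) + \<mu> = 2 * r + 4"
proof -
  have y: "adj z y" "x \<noteq> y" "\<not> adj x y" "u \<noteq> y" "\<not> adj u y" using assms by (auto simp: co_nbh_def)
  have u: "u \<in> co_nbh z y" "u \<noteq> x" using co_nbh_commute[OF y(1) assms(2)] assms adj_irrefl by auto
  let ?A = "{p \<in> common z x y. \<not> adj u p}"
  have "co_nbh z u = ?A \<union> co_nbh z x \<inter> co_nbh z u"
  proof (rule Set.set_eqI)
    fix w
    have "w = y \<or> adj x w \<or> adj y w" if "w \<in> co_nbh z u"
      using co_nbh_adj[OF assms(1,4), of w] that assms(3) by (auto simp: co_nbh_def dest: adj_sym)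
    moreover have "adj y w" if "w \<in> co_nbh z u" "w \<noteq> y"
      using co_nbh_clique[OF assms(2,5) that(1)] that by auto
    ultimately show "w \<in> co_nbh z u \<longleftrightarrow> w \<in> ?A \<union> co_nbh z x \<inter> co_nbh z u"
      using assms y by (auto simp: co_nbh_def common_def dest: adj_sym)
  qed
  moreover have "?A \<inter> (co_nbh z x \<inter> co_nbh z u) = {}" by (auto simp: common_def co_nbh_def)
  ultimately have "card (co_nbh z u) = card ?A + card (co_nbh z x \<inter> co_nbh z u)"
    by (metis (no_types, lifting) card_Un_disjoint finite_Un finite_co_nbh)
  then show ?thesis
    using card_co_nbh[OF assms(2)] card_common_nonadj[OF assms(1,4) u] by simp
qed

text \<open>Disjointness makes \<open>p\<close> adjacent to all of \<open>co_nbh z x\<close>, so by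
  \<open>partner_one\<close> its partner \<open>q\<close> misses all of that set except
  \<open>y\<close>. Together with \<open>p\<close> these are already the \<open>r + 1\<close>
  elements of \<open>co_nbh z q\<close>, and \<open>q\<close> must be adjacent to all of
  \<open>co_nbh z y\<close>.\<close>

lemma co_nbh_disjoint_partner:
  assumes "adj z x" "adj z p" "adj x p" "co_nbh z x \<inter> co_nbh z p = {}"
  obtains y q where "y \<in> co_nbh z x" "p \<in> common z x y" "q \<in> common z x y" "p \<noteq> q" "\<not> adj p q"
    "\<And>w. w \<in> co_nbh z x \<Longrightarrow> adj p w" "\<And>w. w \<in> co_nbh z y \<Longrightarrow> adj q w"
    "\<And>w. w \<in> co_nbh z x \<Longrightarrow> w \<noteq> y \<Longrightarrow> \<not> adj q w"
proof -
  have "co_nbh z x \<noteq> {}" using card_co_nbh[OF assms(1)] by auto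
  then obtain y where y: "y \<in> co_nbh z x" by blast
  then have y': "adj z y" "x \<noteq> y" "\<not> adj x y" by (auto simp: co_nbh_def)
  have pw: "adj p w" if "w \<in> co_nbh z x" for w
    using that assms by (auto simp: co_nbh_def)
  then have p: "p \<in> common z x y" using assms y by (auto simp: common_def dest: adj_sym)
  then obtain q where q: "q \<in> common z x y" "q \<noteq> p" "\<not> adj p q"
    using partner[OF assms(1) y] by blast
  have x: "x \<in> co_nbh z y" using co_nbh_commute[OF assms(1) y'(1)] y by blast
  have comm: "common z y x = common z x y" by (auto simp: common_def)
  have qw: "\<not> adj q w" if "w \<in> co_nbh z x" "w \<noteq> y" for w
    using partner_one[OF y'(1) x, of p q w] p q that pw[OF that(1)] adj_sym comm by metis
  have "insert p (co_nbh z x - {y}) \<subseteq> co_nbh z q"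
    using q p qw by (auto simp: co_nbh_def common_def dest: adj_sym)
  moreover have "card (insert p (co_nbh z x - {y})) = r + 1"
    using card_co_nbh[OF assms(1)] y p by (simp add: co_nbh_def common_def)
  moreover have "card (co_nbh z q) = r + 1" using q by (intro card_co_nbh) (auto simp: common_def)
  ultimately have cq: "insert p (co_nbh z x - {y}) = co_nbh z q"
    by (intro card_subset_eq) auto
  have "adj q w" if "w \<in> co_nbh z y" for w
  proof -
    have "w = x \<or> adj x w" using co_nbh_adj[OF y'(1) x, of w] that by (auto simp: co_nbh_def)
    then have "w \<notin> co_nbh z q"
      using that p assms unfolding cq[symmetric] by (auto simp: co_nbh_def common_def dest: adj_sym)
    moreover have "w \<noteq> q" using that q by (auto simp: co_nbh_def common_def)
    ultimately show ?thesis using that by (auto simp: co_nbh_def)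
  qed
  then show ?thesis using that y p q pw qw by metis
qed

text \<open>For \<open>\<mu> > 4\<close> the nonempty intersections in
  \<open>card_co_nbh_Int\<close> have fewer than \<open>r\<close> elements. This provides an induced
  4-cycle \<open>y, b, a, q\<close> in \<open>nbh z\<close>, whose relation puts the
  \<open>r\<close> elements of \<open>co_nbh z y - {a}\<close> into \<open>co_nbh z b\<close>, too
  many.\<close>

lemma co_nbh_disjoint_mu:
  assumes "adj z x" "adj z p" "adj x p" "co_nbh z x \<inter> co_nbh z p = {}" "r \<ge> 1"
  shows "\<mu> \<le> 4"
proof (rule ccontr)
  assume mu: "\<not> \<mu> \<le> 4"
  obtain y q where y: "y \<in> co_nbh z x" and p: "p \<in> common z x y" and q: "q \<in> common z x y" "p \<noteq> q" "\<not> adj p q"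
    and pw: "\<And>w. w \<in> co_nbh z x \<Longrightarrow> adj p w" and qw: "\<And>w. w \<in> co_nbh z y \<Longrightarrow> adj q w"
    and qw': "\<And>w. w \<in> co_nbh z x \<Longrightarrow> w \<noteq> y \<Longrightarrow> \<not> adj q w"
    by (rule co_nbh_disjoint_partner[OF assms(1-4)]) blast
  have y': "adj z y" "x \<noteq> y" "\<not> adj x y" using y by (auto simp: co_nbh_def)
  have x: "x \<in> co_nbh z y" using co_nbh_commute[OF assms(1) y'(1)] y by blast
  have "card (co_nbh z y - {x}) = r" using card_co_nbh[OF y'(1)] x by simp
  then have "co_nbh z y - {x} \<noteq> {}" using assms(5) by (metis card.empty not_one_le_zero)
  then obtain a where a: "a \<in> co_nbh z y" "a \<noteq> x" by blast
  have xa: "adj x a" using co_nbh_clique[OF y'(1) x a(1)] a by auto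
  have za: "adj z a" "y \<noteq> a" "\<not> adj y a" using a by (auto simp: co_nbh_def)
  have ya: "y \<in> co_nbh z a" using co_nbh_commute[OF y'(1) za(1)] a by blast
  have "\<not> co_nbh z x \<subseteq> co_nbh z a"
  proof
    assume "co_nbh z x \<subseteq> co_nbh z a"
    then have "co_nbh z x \<inter> co_nbh z a = co_nbh z x" by blast
    then show False using card_co_nbh_Int[OF assms(1) za(1) xa y ya] card_co_nbh[OF assms(1)] mu by simp
  qed
  then obtain b where b: "b \<in> co_nbh z x" "b \<notin> co_nbh z a" by blast
  have b': "adj z b" "b \<noteq> a" "b \<noteq> y" "adj a b" using b xa ya by (auto simp: co_nbh_def)
  have yb: "adj y b" using co_nbh_clique[OF assms(1) y b(1)] b' by auto
  have qb: "\<not> adj q b" "q \<noteq> b" using qw' b b' q by (auto simp: co_nbh_def common_def)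
  have qy: "adj q y" "adj q a" "adj q z" using q qw a by (auto simp: common_def dest: adj_sym)
  have xb: "x \<in> co_nbh z b" using co_nbh_commute[OF assms(1) b'(1)] b by blast
  have "co_nbh z y - {a} \<subseteq> co_nbh z y \<inter> co_nbh z b"
  proof
    fix w assume w: "w \<in> co_nbh z y - {a}"
    then have w': "adj z w" "w \<noteq> y" "\<not> adj y w" "w \<in> co_nbh z y" by (auto simp: co_nbh_def)
    have "w \<in> co_nbh z b"
    proof (cases "w = x")
      case False
      have "gram w y + gram w a = gram w q + gram w b"
        using qy qb yb b' za adj_sym adj_V2[OF w'(1)] by (intro four_cycle) blast+
      moreover have "gram w y = 0" using w' by (simp add: gram_nonadj')
      moreover have "gram w a = 1" using co_nbh_clique[OF y'(1) a(1) w'(4)] w by (intro gram_adj') blast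
      moreover have "gram w q = 1" using qw[OF w'(4)] by (simp add: gram_adj')
      ultimately have "gram w b = 0" by simp
      then show ?thesis using w' by (auto simp: co_nbh_def gram_def dest: adj_sym split: if_splits)
    qed (use xb in simp)
    then show "w \<in> co_nbh z y \<inter> co_nbh z b" using w' by blast
  qed
  then have "card (co_nbh z y - {a}) \<le> card (co_nbh z y \<inter> co_nbh z b)"
    by (intro card_mono) auto
  then have "r \<le> card (co_nbh z y \<inter> co_nbh z b)" using card_co_nbh[OF y'(1)] a by simp
  then show False using card_co_nbh_Int[OF y'(1) b'(1) yb x xb] mu by simp
qed

text \<open>All intersections \<open>co_nbh z x \<inter> co_nbh z u\<close> of adjacent
  \<open>x\<close>, \<open>u\<close> now have the same size \<open>H = r + 2 - \<mu> / 2\<close>.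
  Counting incidences gives \<open>\<lambda> H = (r + 1) r\<close>, which factors as
  \<open>(\<mu> - 2) (r + 4 - \<mu>) = 0\<close>; a second moment then bounds
  \<open>r\<close>.\<close>

lemma large_mu:
  assumes "\<mu> > 4" "r \<ge> 1" "V \<noteq> {}"
  shows "\<mu> = r + 4 \<and> r \<le> 4"
    "adj z x \<Longrightarrow> adj z u \<Longrightarrow> adj x u \<Longrightarrow> 2 * card (co_nbh z x \<inter> co_nbh z u) = r"
proof -
  have h: "2 * card (co_nbh z x \<inter> co_nbh z u) + \<mu> = 2 * r + 4" if "adj z x" "adj z u" "adj x u" for z x u
    using card_co_nbh_Int[OF that] co_nbh_disjoint_mu[OF that] assms(1,2) by fastforce
  obtain z where z: "z \<in> V" using assms by blast
  have "nbh z \<noteq> {}" using degree[OF z] mu_pos by (metis add_is_0 card.empty less_irrefl)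
  then obtain x where zx: "adj z x" by blast
  have "card (nbh z \<inter> nbh x) \<noteq> 0" using common_adj[OF zx] assms by auto
  then have "nbh z \<inter> nbh x \<noteq> {}" by auto
  then obtain u where u: "adj z u" "adj x u" by blast
  define H where "H = card (co_nbh z x \<inter> co_nbh z u)"
  have H: "2 * H + \<mu> = 2 * r + 4" "card (co_nbh z x \<inter> co_nbh z u) = H"
    using h[OF zx u] by (auto simp: H_def)
  have H': "card (co_nbh z x \<inter> co_nbh z u) = H" if "adj z x" "adj z u" "adj x u" for x u
    using h[OF that] H by simp
  have "(\<Sum>u\<in>nbh z \<inter> nbh x. card {y \<in> co_nbh z x. y \<in> co_nbh z u}) = (\<Sum>y\<in>co_nbh z x. r)"
  proof (rule sum_multicount_gen, simp, simp, intro ballI)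
    fix y assume y: "y \<in> co_nbh z x"
    then have y': "adj z y" by (auto simp: co_nbh_def)
    have "{u \<in> nbh z \<inter> nbh x. y \<in> co_nbh z u} = co_nbh z y - {x}"
    proof (intro Set.set_eqI iffI)
      fix u assume "u \<in> {u \<in> nbh z \<inter> nbh x. y \<in> co_nbh z u}"
      then show "u \<in> co_nbh z y - {x}"
        using co_nbh_commute[OF y', of u] adj_irrefl by auto
    next
      fix u assume u: "u \<in> co_nbh z y - {x}"
      have xy: "x \<in> co_nbh z y" using y co_nbh_commute[OF zx y'] by blast
      then show "u \<in> {u \<in> nbh z \<inter> nbh x. y \<in> co_nbh z u}"
        using u co_nbh_clique[OF y' xy, of u] co_nbh_commute[OF y', of u] by (auto simp: co_nbh_def)
    qed
    moreover have "x \<in> co_nbh z y" using y co_nbh_commute[OF zx y'] by blast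
    ultimately show "card {u \<in> nbh z \<inter> nbh x. y \<in> co_nbh z u} = r"
      using card_co_nbh[OF y'] by simp
  qed
  moreover have "card {y \<in> co_nbh z x. y \<in> co_nbh z u} = H" if "u \<in> nbh z \<inter> nbh x" for u
  proof -
    have "{y \<in> co_nbh z x. y \<in> co_nbh z u} = co_nbh z x \<inter> co_nbh z u" by blast
    then show ?thesis using H'[OF zx, of u] that by simp
  qed
  ultimately have "card (nbh z \<inter> nbh x) * H = (r + 1) * r"
    using card_co_nbh[OF zx] by simp
  then have "2 * (card (nbh z \<inter> nbh x) * H) = 2 * ((r + 1) * r)" by simp
  then have e1: "(int r + int \<mu> - 2) * (2 * int r + 4 - int \<mu>) = 2 * (int r + 1) * int r"
  proof -
    have "int (card (nbh z \<inter> nbh x)) = int r + int \<mu> - 2" using common_adj[OF zx] by linarith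
    moreover have "2 * int H = 2 * int r + 4 - int \<mu>" using H by linarith
    moreover have "int (card (nbh z \<inter> nbh x)) * int H = (int r + 1) * int r"
      using \<open>card (nbh z \<inter> nbh x) * H = (r + 1) * r\<close> by (metis of_nat_1 of_nat_add of_nat_mult)
    ultimately show ?thesis by (metis mult.assoc mult.left_commute)
  qed
  then have "(int \<mu> - 2) * (int r - (int \<mu> - 4)) = 0" by (simp add: algebra_simps)
  then have mu: "\<mu> = r + 4" using assms(1) by auto
  then have rH: "r = 2 * H" using H by simp
  then show "2 * card (co_nbh z x \<inter> co_nbh z u) = r" if "adj z x" "adj z u" "adj x u" for z x u
    using h[OF that] mu by simp
  \<comment> \<open>To bound \<open>r = 2H\<close>, each \<open>w\<close> in \<open>W\<close> is
    assigned the number of its non-neighbours in \<open>B\<close>. Both moments of these numbers are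
    determined, and for \<open>H > 0\<close> Cauchy--Schwarz becomes
    \<open>(2H - 1)^2 \<le> 3 (2H - 1 + (H - 1) (H - 2))\<close>.\<close>
  define B where "B = co_nbh z x \<inter> co_nbh z u"
  define W where "W = nbh z \<inter> nbh x \<inter> nbh u"
  have W: "finite W" "card W = 3 * H"
    using triangle_count[OF zx u] H mu rH by (auto simp: W_def)
  have B: "finite B" "card B = H" using H by (auto simp: B_def)
  have Wco_nbh: "{w \<in> W. y \<in> co_nbh z w} = co_nbh z y - {x, u}" "x \<in> co_nbh z y" "u \<in> co_nbh z y" "adj z y"
    if "y \<in> B" for y
  proof -
    show y: "adj z y" using that by (auto simp: B_def co_nbh_def)
    show xy: "x \<in> co_nbh z y" "u \<in> co_nbh z y"
      using that co_nbh_commute[OF y zx] co_nbh_commute[OF y u(1)] by (auto simp: B_def)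
    show "{w \<in> W. y \<in> co_nbh z w} = co_nbh z y - {x, u}"
    proof (intro Set.set_eqI iffI)
      fix w assume "w \<in> {w \<in> W. y \<in> co_nbh z w}"
      then show "w \<in> co_nbh z y - {x, u}"
        using co_nbh_commute[OF y, of w] adj_irrefl by (auto simp: W_def)
    next
      fix w assume "w \<in> co_nbh z y - {x, u}"
      then show "w \<in> {w \<in> W. y \<in> co_nbh z w}"
        using co_nbh_clique[OF y xy(1), of w] co_nbh_clique[OF y xy(2), of w] co_nbh_commute[OF y, of w]
        by (auto simp: W_def co_nbh_def)
    qed
  qed
  have xu: "x \<noteq> u" using u adj_irrefl by auto
  have "(\<Sum>w\<in>W. card {y \<in> B. y \<in> co_nbh z w}) = (\<Sum>y\<in>B. r - 1)"
  proof (rule sum_multicount_gen, fact, fact, intro ballI)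
    fix y assume "y \<in> B"
    then show "card {w \<in> W. y \<in> co_nbh z w} = r - 1"
      using Wco_nbh[OF \<open>y \<in> B\<close>] card_co_nbh[of z y] xu by (simp add: card_Diff_subset)
  qed
  then have s1: "(\<Sum>w\<in>W. card {y \<in> B. y \<in> co_nbh z w}) = H * (r - 1)" using B by simp
  \<comment> \<open>Distinct \<open>y\<close>, \<open>y'\<close> in \<open>B\<close> have
    \<open>H\<close> common non-neighbours, two of which, \<open>x\<close> and \<open>u\<close>, are
    not in \<open>W\<close>. If \<open>H < 2\<close> there are no such pairs, so the truncation of
    \<open>H - 2\<close> does no harm.\<close>
  have "(\<Sum>w\<in>W. card {P \<in> B \<times> B. fst P \<in> co_nbh z w \<and> snd P \<in> co_nbh z w}) =
      (\<Sum>P\<in>B \<times> B. if fst P = snd P then r - 1 else H - 2)"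
  proof (rule sum_multicount_gen, fact, simp add: B, intro ballI)
    fix P assume P: "P \<in> B \<times> B"
    obtain y y' where P': "P = (y, y')" "y \<in> B" "y' \<in> B" using P by auto
    have "{w \<in> W. fst P \<in> co_nbh z w \<and> snd P \<in> co_nbh z w} = {w \<in> W. y \<in> co_nbh z w} \<inter> {w \<in> W. y' \<in> co_nbh z w}"
      by (auto simp: P')
    also have "\<dots> = co_nbh z y \<inter> co_nbh z y' - {x, u}"
      using Wco_nbh(1)[OF P'(2)] Wco_nbh(1)[OF P'(3)] by blast
    finally have *: "{w \<in> W. fst P \<in> co_nbh z w \<and> snd P \<in> co_nbh z w} = co_nbh z y \<inter> co_nbh z y' - {x, u}" .
    have "card (co_nbh z y \<inter> co_nbh z y' - {x, u}) = card (co_nbh z y \<inter> co_nbh z y') - 2"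
      using Wco_nbh[OF P'(2)] Wco_nbh[OF P'(3)] xu by (subst card_Diff_subset) auto
    moreover have "card (co_nbh z y \<inter> co_nbh z y') = (if y = y' then r + 1 else H)"
    proof (cases "y = y'")
      case False
      have "adj y y'" using co_nbh_clique[OF zx, of y y'] P' False by (auto simp: B_def)
      then show ?thesis using H'[of y y'] Wco_nbh(4)[OF P'(2)] Wco_nbh(4)[OF P'(3)] False by simp
    qed (use card_co_nbh[OF Wco_nbh(4)[OF P'(2)]] in simp)
    ultimately show "card {w \<in> W. fst P \<in> co_nbh z w \<and> snd P \<in> co_nbh z w} = (if fst P = snd P then r - 1 else H - 2)"
      unfolding * by (simp add: P')
  qed
  moreover have "{P \<in> B \<times> B. fst P \<in> co_nbh z w \<and> snd P \<in> co_nbh z w} =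
      {y \<in> B. y \<in> co_nbh z w} \<times> {y \<in> B. y \<in> co_nbh z w}" for w
    by auto
  moreover have "(\<Sum>P\<in>B \<times> B. if fst P = snd P then r - 1 else H - 2) = H * ((r - 1) + (H - 1) * (H - 2))"
  proof -
    have "(\<Sum>P\<in>B \<times> B. if fst P = snd P then r - 1 else H - 2) = (\<Sum>y\<in>B. \<Sum>y'\<in>B. if y = y' then r - 1 else H - 2)"
      by (simp add: sum.cartesian_product case_prod_unfold)
    also have "\<dots> = (\<Sum>y\<in>B. (r - 1) + (H - 1) * (H - 2))"
    proof (rule sum.cong[OF refl])
      fix y assume "y \<in> B"
      have "(\<Sum>y'\<in>B. if y = y' then r - 1 else H - 2) = (r - 1) + (\<Sum>y'\<in>B-{y}. H - 2)"
      proof -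
        have "(\<Sum>y'\<in>B-{y}. if y = y' then r - 1 else H - 2) = (\<Sum>y'\<in>B-{y}. H - 2)"
          by (intro sum.cong) auto
        then show ?thesis using sum.remove[OF B(1) \<open>y \<in> B\<close>, of "\<lambda>y'. if y = y' then r - 1 else H - 2"] by simp
      qed
      then show "(\<Sum>y'\<in>B. if y = y' then r - 1 else H - 2) = (r - 1) + (H - 1) * (H - 2)"
        using \<open>y \<in> B\<close> B by simp
    qed
    finally show ?thesis using B by simp
  qed
  ultimately have s2: "(\<Sum>w\<in>W. (card {y \<in> B. y \<in> co_nbh z w})\<^sup>2) = H * ((r - 1) + (H - 1) * (H - 2))"
    by (simp add: card_cartesian_product power2_eq_square)
  define f where "f w = int (card {y \<in> B. y \<in> co_nbh z w})" for w
  have "(\<Sum>w\<in>W. f w)\<^sup>2 \<le> int (card W) * (\<Sum>w\<in>W. (f w)\<^sup>2)"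
    using sum_sq_le_card_mult[of f W] by simp
  moreover have "(\<Sum>w\<in>W. f w) = int (H * (r - 1))"
    unfolding s1[symmetric] f_def by simp
  moreover have "(\<Sum>w\<in>W. (f w)\<^sup>2) = int (H * ((r - 1) + (H - 1) * (H - 2)))"
    unfolding s2[symmetric] f_def by simp
  ultimately have "(int (H * (r - 1)))\<^sup>2 \<le> int (3 * H) * int (H * ((r - 1) + (H - 1) * (H - 2)))"
    using W by simp
  then have ineq: "(H * (r - 1))\<^sup>2 \<le> 3 * H * (H * ((r - 1) + (H - 1) * (H - 2)))"
    by (simp flip: of_nat_mult of_nat_power)
  have "H \<le> 2"
  proof (rule ccontr)
    assume "\<not> H \<le> 2"
    then obtain j where j: "H = j + 3" by (metis add.commute le_Suc_ex not_less_eq_eq numeral_2_eq_2 numeral_3_eq_3)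
    have "(H * (r - 1))\<^sup>2 = (H * H) * (2 * j + 5)\<^sup>2"
      by (simp add: rH j power2_eq_square algebra_simps)
    moreover have "3 * H * (H * ((r - 1) + (H - 1) * (H - 2))) = (H * H) * (3 * (2 * j + 5 + (j + 2) * (j + 1)))"
      by (simp add: rH j algebra_simps)
    ultimately have "(2 * j + 5)\<^sup>2 \<le> 3 * (2 * j + 5 + (j + 2) * (j + 1))"
      using ineq j by simp
    then show False by (simp add: power2_eq_square algebra_simps)
  qed
  then show "\<mu> = r + 4 \<and> r \<le> 4" using mu rH by simp
qed

end

section \<open>Recognizing triangular graphs\<close>

context srg_no_claw begin

text \<open>In a triangular graph the neighbours of \<open>{i, j}\<close> split into the pairs through \<open>i\<close> and the
  pairs through \<open>j\<close>.\<close>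

definition split :: "'a \<Rightarrow> 'a set \<Rightarrow> 'a set \<Rightarrow> bool" where
  "split z K L \<longleftrightarrow> nbh z = K \<union> L \<and> K \<inter> L = {} \<and> card K = r + 2 \<and> card L = r + 2 \<and>
     pairwise adj K \<and> pairwise adj L"

lemma split_commute: "split z K L \<Longrightarrow> split z L K"
  by (auto simp: split_def)

text \<open>For \<open>\<mu> = 4\<close> the set \<open>common z x y\<close> is just
  \<open>{p, q}\<close>, so every other neighbour of \<open>z\<close> misses \<open>x\<close> or
  \<open>y\<close>. The clique \<open>co_nbh z x\<close> is extended by \<open>p\<close> and the
  clique \<open>co_nbh z y\<close> by \<open>q\<close>.\<close>

lemma split_if_co_nbh_disjoint:
  assumes "\<mu> = 4" "adj z x" "adj z p" "adj x p" "co_nbh z x \<inter> co_nbh z p = {}"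
  obtains K L where "split z K L"
proof -
  obtain y q where y: "y \<in> co_nbh z x" and p: "p \<in> common z x y" and q: "q \<in> common z x y" "p \<noteq> q" "\<not> adj p q"
    and pw: "\<And>w. w \<in> co_nbh z x \<Longrightarrow> adj p w" and qw: "\<And>w. w \<in> co_nbh z y \<Longrightarrow> adj q w"
    and qw': "\<And>w. w \<in> co_nbh z x \<Longrightarrow> w \<noteq> y \<Longrightarrow> \<not> adj q w"
    by (rule co_nbh_disjoint_partner[OF assms(2-5)]) blast
  have y': "adj z y" "x \<noteq> y" "\<not> adj x y" using y by (auto simp: co_nbh_def)
  have x: "x \<in> co_nbh z y" using co_nbh_commute[OF assms(2) y'(1)] y by blast
  have "card (common z x y) = card {p, q}" using card_common[OF assms(2) y] assms(1) q by simp
  then have D: "{p, q} = common z x y"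
    using p q by (intro card_subset_eq) (auto simp: common_def)
  have "split z (insert q (co_nbh z y)) (insert p (co_nbh z x))"
    unfolding split_def
  proof (intro conjI)
    have *: "w \<in> insert q (co_nbh z y) \<union> insert p (co_nbh z x)" if w: "w \<in> nbh z" for w
    proof (cases "w \<in> common z x y")
      case False
      then have "\<not> adj x w \<or> \<not> adj y w" using w by (auto simp: common_def)
      moreover have "w = x \<or> w = y \<or> adj x w \<or> adj y w"
        using co_nbh_adj[OF assms(2) y w] by blast
      ultimately show ?thesis using w x y by (auto simp: co_nbh_def)
    qed (use D in blast)
    then show "nbh z = insert q (co_nbh z y) \<union> insert p (co_nbh z x)"
      using p q by (auto simp: common_def co_nbh_def)
    have "q \<notin> co_nbh z x" "p \<notin> co_nbh z y" "q \<notin> co_nbh z y" "p \<notin> co_nbh z x"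
      using p q by (auto simp: common_def co_nbh_def)
    moreover have "co_nbh z x \<inter> co_nbh z y = {}"
      using co_nbh_clique[OF assms(2) y] y' by (auto simp: co_nbh_def)
    ultimately show "insert q (co_nbh z y) \<inter> insert p (co_nbh z x) = {}" "card (insert q (co_nbh z y)) = r + 2"
      "card (insert p (co_nbh z x)) = r + 2"
      using q card_co_nbh[OF assms(2)] card_co_nbh[OF y'(1)] by auto
    show "pairwise adj (insert q (co_nbh z y))" "pairwise adj (insert p (co_nbh z x))"
      using co_nbh_clique[OF assms(2)] co_nbh_clique[OF y'(1)] pw qw adj_sym[OF pw] adj_sym[OF qw]
      by (simp_all add: pairwise_def)
  qed
  then show ?thesis using that by blast
qed

text \<open>Of the \<open>\<lambda> = r + 2\<close> common neighbours of \<open>z\<close> and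
  \<open>a\<close>, \<open>r + 1\<close> lie in \<open>K\<close>, which leaves one in
  \<open>L\<close>: the edges between \<open>K\<close> and \<open>L\<close> form a perfect
  matching.\<close>

lemma split_cross:
  assumes "\<mu> = 4" "split z K L" "a \<in> K"
  obtains b where "b \<in> L" "\<And>b'. b' \<in> L \<Longrightarrow> adj a b' \<longleftrightarrow> b' = b"
proof -
  have s: "nbh z = K \<union> L" "K \<inter> L = {}" "card K = r + 2" "pairwise adj K"
    using assms(2) by (auto simp: split_def)
  have fin: "finite K" "finite L" using s(1) finite_nbh[of z] by auto
  have za: "adj z a" using s(1) assms(3) by blast
  have "nbh z \<inter> nbh a = (K - {a}) \<union> (nbh a \<inter> L)"
    using s assms(3) adj_irrefl by (auto simp: pairwise_def)
  moreover have "(K - {a}) \<inter> (nbh a \<inter> L) = {}" using s(2) by blast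
  ultimately have "card (nbh z \<inter> nbh a) = card (K - {a}) + card (nbh a \<inter> L)"
    using fin by (simp add: card_Un_disjoint)
  moreover have "card (K - {a}) = r + 1" using s(3) assms(3) fin by simp
  ultimately have "card (nbh a \<inter> L) = 1" using common_adj[OF za] assms(1) by simp
  then obtain b where "nbh a \<inter> L = {b}" by (auto simp: card_1_singleton_iff)
  then show ?thesis using that by blast
qed

text \<open>If \<open>b\<close> is matched to \<open>a\<close>, no vertex is adjacent to all of
  \<open>z\<close>, \<open>a\<close>, \<open>b\<close>. By \<open>triangle_count\<close> with
  \<open>\<mu> = 4\<close>, the sets \<open>co_nbh a z\<close> and \<open>co_nbh a b\<close> are
  then disjoint, which is the criterion for a split at \<open>a\<close>.\<close>

lemma split_propagate:
  assumes "\<mu> = 4" "split z K L" "a \<in> K"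
  obtains K' L' where "split a K' L'"
proof -
  have s: "nbh z = K \<union> L" "K \<inter> L = {}" using assms(2) by (auto simp: split_def)
  obtain b where b: "b \<in> L" "\<And>b'. b' \<in> L \<Longrightarrow> adj a b' \<longleftrightarrow> b' = b"
    by (rule split_cross[OF assms]) blast
  obtain a' where a': "a' \<in> K" "\<And>w. w \<in> K \<Longrightarrow> adj b w \<longleftrightarrow> w = a'"
    by (rule split_cross[OF assms(1) split_commute[OF assms(2)] b(1)]) blast
  have ab: "adj a b" using b by blast
  then have "a' = a" using a' assms(3) adj_sym by blast
  have za: "adj z a" "adj z b" using s assms(3) b by auto
  have "nbh a \<inter> nbh z \<inter> nbh b = {}"
    using a' b \<open>a' = a\<close> s adj_irrefl by blast
  then have "card (co_nbh a z \<inter> co_nbh a b) = 0"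
    using triangle_count[OF adj_sym[OF za(1)] ab za(2)] assms(1) by simp
  then have "co_nbh a z \<inter> co_nbh a b = {}" by simp
  then show ?thesis
    using split_if_co_nbh_disjoint[OF assms(1) adj_sym[OF za(1)] ab za(2)] that by blast
qed

text \<open>These cliques play the role of the points \<open>1, ..., m\<close>: in
  \<open>T(m)\<close> with \<open>m = r + 4 \<ge> 5\<close>, the cliques of \<open>m - 1\<close>
  vertices are the sets of all pairs through a point.\<close>

definition lines :: "'a set set" where
  "lines = {C. C \<subseteq> V \<and> card C = r + 3 \<and> pairwise adj C}"

lemma finite_lines: "finite lines"
  using finite_V by (auto simp: lines_def intro: finite_subset[of _ "Pow V"])

lemma split_line:
  assumes "split z K L"
  shows "insert z K \<in> lines"
proof -
  have s: "nbh z = K \<union> L" "card K = r + 2" "pairwise adj K"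
    using assms by (auto simp: split_def)
  have fin: "finite K" using s(1) finite_nbh[of z] by auto
  have zK: "z \<notin> K" "\<And>a. a \<in> K \<Longrightarrow> adj z a" using s(1) adj_irrefl by blast+
  have "K \<noteq> {}" using s(2) by auto
  then have "z \<in> V" using zK adj_V by blast
  then show ?thesis
    using zK s fin nbh_subset[of z] by (auto simp: lines_def pairwise_def dest: adj_sym)
qed

text \<open>Since the edges between \<open>K\<close> and \<open>L\<close> form a matching, a clique
  through \<open>z\<close> that meets both sides has only 3 vertices, fewer than
  \<open>r + 3\<close>.\<close>

lemma lines_through:
  assumes "\<mu> = 4" "r \<ge> 1" "split z K L"
  shows "{C \<in> lines. z \<in> C} = {insert z K, insert z L}"
proof
  have s: "nbh z = K \<union> L" "K \<inter> L = {}" "card K = r + 2" "card L = r + 2"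
    using assms by (auto simp: split_def)
  have fin: "finite K" "finite L" using s(1) finite_nbh[of z] by auto
  show "{insert z K, insert z L} \<subseteq> {C \<in> lines. z \<in> C}"
    using split_line[OF assms(3)] split_line[OF split_commute[OF assms(3)]] by blast
  show "{C \<in> lines. z \<in> C} \<subseteq> {insert z K, insert z L}"
  proof
    fix C assume "C \<in> {C \<in> lines. z \<in> C}"
    then have C: "C \<subseteq> V" "card C = r + 3" "pairwise adj C" "z \<in> C" by (auto simp: lines_def)
    have fC: "finite C" using C(1) by (rule finite_sub)
    define D where "D = C - {z}"
    have D: "card D = r + 2" "C = insert z D" using C fC by (auto simp: D_def)
    have fD: "finite D" using fC by (simp add: D_def)
    have Dadj: "adj v w" if "v \<in> D" "w \<in> D" "v \<noteq> w" for v w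
      using that C(3) by (auto simp: D_def pairwise_def)
    have DKL: "D \<subseteq> K \<union> L" using C(3,4) s(1) by (auto simp: D_def pairwise_def)
    have "\<not> (\<exists>a\<in>D. \<exists>b\<in>D. a \<in> K \<and> b \<in> L)"
    proof
      assume "\<exists>a\<in>D. \<exists>b\<in>D. a \<in> K \<and> b \<in> L"
      then obtain a b where ab: "a \<in> D" "b \<in> D" "a \<in> K" "b \<in> L" by blast
      obtain b0 where b0: "\<And>b'. b' \<in> L \<Longrightarrow> adj a b' \<longleftrightarrow> b' = b0"
        by (rule split_cross[OF assms(1,3) ab(3)]) blast
      obtain a0 where a0: "\<And>w. w \<in> K \<Longrightarrow> adj b w \<longleftrightarrow> w = a0"
        by (rule split_cross[OF assms(1) split_commute[OF assms(3)] ab(4)]) blast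
      have "a \<noteq> b" using ab s(2) by blast
      have "w = a \<or> w = b" if "w \<in> D" for w
      proof (rule ccontr)
        assume "\<not> (w = a \<or> w = b)"
        then have "adj a w" "adj b w" "adj a b" "adj b a" using Dadj that ab \<open>a \<noteq> b\<close> by blast+
        then show False using b0[of w] b0[of b] a0[of w] a0[of a] ab that DKL \<open>\<not> (w = a \<or> w = b)\<close> by blast
      qed
      then have "D \<subseteq> {a, b}" by blast
      then have "card D \<le> card {a, b}" by (intro card_mono) auto
      then show False using D(1) assms(2) by (simp add: card_insert_if split: if_splits)
    qed
    then have "D \<subseteq> K \<or> D \<subseteq> L" using DKL by blast
    then have "D = K \<or> D = L" using card_subset_eq fin D(1) s(3,4) by metis
    then show "C \<in> {insert z K, insert z L}" using D(2) by blast
  qed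
qed

text \<open>By connectivity every vertex has a split and hence lies on two lines, and distinct
  vertices share a line, never two, exactly if adjacent. Counting incidences,
  \<open>(r + 3) |lines| = 2 |V|\<close>, gives \<open>r + 4\<close> lines; so \<open>|V|\<close> is
  the number of pairs of lines, and the injection \<open>f\<close> hits them all.\<close>

lemma triangular:
  assumes "\<mu> = 4" "r \<ge> 1" "adj z0 x" "adj z0 p" "adj x p" "co_nbh z0 x \<inter> co_nbh z0 p = {}"
    and conn: "\<And>P. P \<subseteq> V \<Longrightarrow> P \<noteq> {} \<Longrightarrow> (\<And>a b. a \<in> P \<Longrightarrow> adj a b \<Longrightarrow> b \<in> P) \<Longrightarrow> P = V"
  obtains g :: "'a \<Rightarrow> nat set" where "bij_betw g V {A. A \<subseteq> {1..r + 4} \<and> card A = 2}"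
    "\<And>a b. a \<in> V \<Longrightarrow> b \<in> V \<Longrightarrow> adj a b \<longleftrightarrow> card (g a \<inter> g b) = 1"
proof -
  define P where "P = {z \<in> V. \<exists>K L. split z K L}"
  have "P = V"
  proof (rule conn)
    show "P \<subseteq> V" by (auto simp: P_def)
    obtain K L where "split z0 K L" using split_if_co_nbh_disjoint[OF assms(1,3-6)] .
    then show "P \<noteq> {}" using adj_V[OF assms(3)] by (auto simp: P_def)
    fix a b assume ab: "a \<in> P" "adj a b"
    then obtain K L where KL: "split a K L" by (auto simp: P_def)
    have "b \<in> K \<or> b \<in> L" using ab KL by (auto simp: split_def)
    then have "\<exists>K' L'. split b K' L'"
      using split_propagate[OF assms(1) KL] split_propagate[OF assms(1) split_commute[OF KL]] by metis
    then show "b \<in> P" using ab(2) adj_V2 by (auto simp: P_def)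
  qed
  then have ex: "\<exists>K L. split z K L" if "z \<in> V" for z using that by (auto simp: P_def)
  define f where "f z = {C \<in> lines. z \<in> C}" for z
  have f: "card (f z) = 2" "\<Union>(f z) = insert z (nbh z)" "w \<noteq> z \<Longrightarrow> card {C \<in> f z. w \<in> C} \<le> 1" if z: "z \<in> V" for z w
  proof -
    obtain K L where KL: "split z K L" using ex[OF z] by blast
    have s: "nbh z = K \<union> L" "K \<inter> L = {}" "card K = r + 2" "z \<notin> K" "z \<notin> L"
      using KL adj_irrefl by (auto simp: split_def)
    have fz: "f z = {insert z K, insert z L}"
      using lines_through[OF assms(1,2) KL] by (simp add: f_def)
    have "K \<noteq> {}" using s(3) by auto
    then obtain a where "a \<in> K" by blast
    then have "a \<notin> insert z L" using s(2,4) by auto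
    then have ne: "insert z K \<noteq> insert z L" using \<open>a \<in> K\<close> by auto
    show "card (f z) = 2" using ne by (simp add: fz)
    show "\<Union>(f z) = insert z (nbh z)" using s by (auto simp: fz)
    show "card {C \<in> f z. w \<in> C} \<le> 1" if "w \<noteq> z"
    proof (rule ccontr)
      assume "\<not> ?thesis"
      then have "card {C \<in> f z. w \<in> C} \<ge> card (f z)" using \<open>card (f z) = 2\<close> by simp
      moreover have "{C \<in> f z. w \<in> C} \<subseteq> f z" "finite (f z)" by (auto simp: fz)
      ultimately have "{C \<in> f z. w \<in> C} = f z" by (metis card_mono card_subset_eq le_antisym)
      then have "\<forall>C\<in>f z. w \<in> C" by blast
      then have "w \<in> insert z K" "w \<in> insert z L" unfolding fz by simp_all
      then show False using that s(2) by blast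
    qed
  qed
  have subf: "f z \<subseteq> lines" for z by (auto simp: f_def)
  have "inj_on f V"
  proof (rule inj_onI, rule ccontr)
    fix z w assume zw: "z \<in> V" "w \<in> V" "f z = f w" "z \<noteq> w"
    have "{C \<in> f z. w \<in> C} = f z" using zw(3) by (auto simp: f_def)
    then show False using f(1)[OF zw(1)] f(3)[OF zw(1), of w] zw(4) by simp
  qed
  have adj_f: "adj a b \<longleftrightarrow> card (f a \<inter> f b) = 1" if ab: "a \<in> V" "b \<in> V" for a b
  proof (cases "a = b")
    case True
    then show ?thesis using f(1)[OF ab(1)] adj_irrefl by simp
  next
    case False
    have *: "f a \<inter> f b = {C \<in> f a. b \<in> C}" by (auto simp: f_def)
    have fin: "finite (f a \<inter> f b)" using subf finite_lines finite_subset by blast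
    have "b \<in> \<Union>(f a) \<longleftrightarrow> adj a b" using f(2)[OF ab(1)] False by simp
    then have "adj a b \<longleftrightarrow> f a \<inter> f b \<noteq> {}" unfolding * by auto
    moreover have "card (f a \<inter> f b) \<le> 1" unfolding * using f(3)[OF ab(1), of b] False by simp
    ultimately show ?thesis using card_0_eq[OF fin] by linarith
  qed
  have Vne: "V \<noteq> {}" using adj_V[OF assms(3)] by blast
  have v: "2 * card V = (r + 4) * (r + 3)"
  proof -
    have "4 * int (card V) = (2 * int r + 6) * (int r + 4)" using card_V[OF Vne] assms(1) by simp
    then have "2 * int (card V) = int ((r + 4) * (r + 3))" by (simp add: algebra_simps)
    then show ?thesis by linarith
  qed
  have "(\<Sum>C\<in>lines. card {z \<in> V. z \<in> C}) = (\<Sum>z\<in>V. 2)"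
    using finite_lines finite_V f(1) by (intro sum_multicount_gen) (auto simp: f_def)
  moreover have "card {z \<in> V. z \<in> C} = r + 3" if "C \<in> lines" for C
  proof -
    have "{z \<in> V. z \<in> C} = C" using that by (auto simp: lines_def)
    then show ?thesis using that by (simp add: lines_def)
  qed
  ultimately have "card lines * (r + 3) = 2 * card V" by simp
  then have cl: "card lines = r + 4" using v by (metis add_gr_0 mult_cancel2 nat_neq_iff zero_less_numeral)
  have im: "f ` V = {A. A \<subseteq> lines \<and> card A = 2}"
  proof (rule card_subset_eq)
    show "finite {A. A \<subseteq> lines \<and> card A = 2}" using finite_lines by simp
    show "f ` V \<subseteq> {A. A \<subseteq> lines \<and> card A = 2}" using subf f(1) by auto
    have "card {A. A \<subseteq> lines \<and> card A = 2} = (r + 4) choose 2"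
      using n_subsets[OF finite_lines, of 2] cl by simp
    also have "\<dots> = card V" using v by (simp add: choose_two algebra_simps)
    finally show "card (f ` V) = card {A. A \<subseteq> lines \<and> card A = 2}"
      using \<open>inj_on f V\<close> by (simp add: card_image)
  qed
  obtain h where h: "bij_betw h lines {1..r + 4}"
    using finite_same_card_bij[OF finite_lines, of "{1..r + 4}"] cl by auto
  define g where "g z = h ` f z" for z
  have injh: "inj_on h lines" and imh: "h ` lines = {1..r + 4}" using h by (auto simp: bij_betw_def)
  have "inj_on g V"
  proof (rule inj_onI)
    fix a b assume "a \<in> V" "b \<in> V" "g a = g b"
    then have "f a = f b" unfolding g_def using inj_on_image_eq_iff[OF injh subf subf] by blast
    then show "a = b" using \<open>inj_on f V\<close> \<open>a \<in> V\<close> \<open>b \<in> V\<close> by (auto dest: inj_onD)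
  qed
  moreover have "g ` V = {A. A \<subseteq> {1..r + 4} \<and> card A = 2}"
  proof
    show "g ` V \<subseteq> {A. A \<subseteq> {1..r + 4} \<and> card A = 2}"
    proof
      fix A assume "A \<in> g ` V"
      then obtain z where z: "z \<in> V" "A = h ` f z" by (auto simp: g_def)
      have "h ` f z \<subseteq> {1..r + 4}" using imh subf[of z] by blast
      moreover have "card (h ` f z) = 2"
        using card_image[OF inj_on_subset[OF injh subf]] f(1)[OF z(1)] by simp
      ultimately show "A \<in> {A. A \<subseteq> {1..r + 4} \<and> card A = 2}" using z by simp
    qed
    show "{A. A \<subseteq> {1..r + 4} \<and> card A = 2} \<subseteq> g ` V"
    proof
      fix A assume "A \<in> {A. A \<subseteq> {1..r + 4} \<and> card A = 2}"
      then have A: "A \<subseteq> h ` lines" "card A = 2" by (auto simp: imh)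
      then obtain B where B: "B \<subseteq> lines" "A = h ` B" by (auto simp: subset_image_iff)
      have "card B = 2" using A(2) B card_image[OF inj_on_subset[OF injh B(1)]] by simp
      then have "B \<in> f ` V" using B(1) by (simp add: im)
      then show "A \<in> g ` V" using B(2) by (auto simp: g_def)
    qed
  qed
  ultimately have "bij_betw g V {A. A \<subseteq> {1..r + 4} \<and> card A = 2}" by (simp add: bij_betw_def)
  moreover have "adj a b \<longleftrightarrow> card (g a \<inter> g b) = 1" if "a \<in> V" "b \<in> V" for a b
  proof -
    have "g a \<inter> g b = h ` (f a \<inter> f b)"
      unfolding g_def using inj_on_image_Int[OF injh subf subf] by simp
    moreover have "f a \<inter> f b \<subseteq> lines" using subf by blast
    ultimately have "card (g a \<inter> g b) = card (f a \<inter> f b)"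
      using card_image[OF inj_on_subset[OF injh]] by simp
    then show ?thesis using adj_f[OF that] by simp
  qed
  ultimately show ?thesis using that by blast
qed

end

section \<open>Small cuts\<close>

lemma card_Un3:
  assumes "finite X" "finite Y" "finite Z"
  shows "card (X \<union> Y \<union> Z) + card (X \<inter> Y) + card (X \<inter> Z) + card (Y \<inter> Z) =
    card X + card Y + card Z + card (X \<inter> Y \<inter> Z)"
proof -
  have "card X + card Y = card (X \<union> Y) + card (X \<inter> Y)"
    using assms by (intro card_Un_Int)
  moreover have "card (X \<union> Y) + card Z = card (X \<union> Y \<union> Z) + card ((X \<union> Y) \<inter> Z)"
    using assms by (intro card_Un_Int) auto
  moreover have "card (X \<inter> Z) + card (Y \<inter> Z) = card ((X \<union> Y) \<inter> Z) + card (X \<inter> Y \<inter> Z)"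
  proof -
    have "(X \<union> Y) \<inter> Z = X \<inter> Z \<union> Y \<inter> Z" "X \<inter> Y \<inter> Z = X \<inter> Z \<inter> (Y \<inter> Z)" by auto
    then show ?thesis using card_Un_Int[of "X \<inter> Z" "Y \<inter> Z"] assms by simp
  qed
  ultimately show ?thesis by linarith
qed

context srg_neg2 begin

text \<open>The removed set is \<open>V - A - B\<close>, and the last clause bounds its size by
  \<open>3r + \<mu> = 2k - \<lambda> - 2\<close> without subtraction. \<open>A\<close> and
  \<open>B\<close> need not be connected; that components have at least two vertices enters only as
  the absence of isolated vertices.\<close>

definition small_cut :: "'a set \<Rightarrow> 'a set \<Rightarrow> bool" where
  "small_cut A B \<longleftrightarrow> A \<subseteq> V \<and> B \<subseteq> V \<and> A \<inter> B = {} \<and> (\<forall>a\<in>A. \<forall>b\<in>B. \<not> adj a b) \<and> A \<noteq> {} \<and> B \<noteq> {} \<and>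
     (\<forall>a\<in>A. \<exists>a'\<in>A. adj a a') \<and> (\<forall>b\<in>B. \<exists>b'\<in>B. adj b b') \<and>
     card V < card A + card B + 3 * r + \<mu>"

lemma small_cut_commute: "small_cut A B \<Longrightarrow> small_cut B A"
  by (auto simp: small_cut_def dest: adj_sym)

lemma card_nbh_Un:
  assumes "adj x y"
  shows "card (nbh x \<union> nbh y) = 3 * r + \<mu> + 2"
  using card_Un_Int[of "nbh x" "nbh y"] degree[OF adj_V[OF assms]] degree[OF adj_V2[OF assms]]
    common_adj[OF assms] by simp

text \<open>Otherwise the edge \<open>x y\<close> has no further neighbours in \<open>A\<close>, and
  the other \<open>3r + \<mu>\<close> vertices of \<open>nbh x \<union> nbh y\<close> all belong to
  the cut, too many.\<close>

lemma small_cut_path: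
  assumes "small_cut A B"
  obtains x y z where "x \<in> A" "y \<in> A" "z \<in> A" "adj x y" "adj y z" "x \<noteq> z"
proof -
  have c: "A \<subseteq> V" "B \<subseteq> V" "A \<inter> B = {}" "\<And>a b. a \<in> A \<Longrightarrow> b \<in> B \<Longrightarrow> \<not> adj a b" "card V < card A + card B + 3 * r + \<mu>"
    using assms by (auto simp: small_cut_def)
  obtain x where "x \<in> A" using assms by (auto simp: small_cut_def)
  moreover from this obtain y where "y \<in> A" "adj x y" using assms unfolding small_cut_def by blast
  ultimately have xy: "x \<in> A" "y \<in> A" "adj x y" by blast+
  have "\<exists>z\<in>A. z \<noteq> x \<and> z \<noteq> y \<and> (adj x z \<or> adj y z)"
  proof (rule ccontr)
    assume no: "\<not> ?thesis"
    let ?U = "nbh x \<union> nbh y"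
    have "?U \<inter> (A \<union> B) \<subseteq> {x, y}" using no c(4) xy by blast
    then have "card (?U \<inter> (A \<union> B)) \<le> card {x, y}" by (intro card_mono) auto
    also have "\<dots> \<le> 2" by (simp add: card_insert_if)
    finally have "card (?U \<inter> (A \<union> B)) \<le> 2" .
    moreover have "finite (A \<union> B)" using c by (auto intro: finite_sub)
    then have "card ?U + card (A \<union> B) = card (?U \<union> (A \<union> B)) + card (?U \<inter> (A \<union> B))"
      by (intro card_Un_Int) auto
    moreover have "card (?U \<union> (A \<union> B)) \<le> card V"
      using c nbh_subset finite_V by (intro card_mono) auto
    moreover have "card (A \<union> B) = card A + card B"
      using c by (intro card_Un_disjoint finite_sub)
    ultimately show False using c(5) card_nbh_Un[OF xy(3)] by linarith
  qed
  then show ?thesis using that xy adj_sym by blast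
qed

lemma small_cut_far:
  assumes "small_cut A B" "x \<in> A" "y \<in> A" "z \<in> A"
  shows "card B + card (nbh x \<union> nbh y \<union> nbh z) \<le> card V"
proof -
  have c: "A \<subseteq> V" "B \<subseteq> V" "A \<inter> B = {}" "\<And>a b. a \<in> A \<Longrightarrow> b \<in> B \<Longrightarrow> \<not> adj a b"
    using assms by (auto simp: small_cut_def)
  have "card B + card (nbh x \<union> nbh y \<union> nbh z) = card (B \<union> (nbh x \<union> nbh y \<union> nbh z))"
    using c assms by (subst card_Un_disjoint) (auto intro: finite_sub)
  also have "\<dots> \<le> card V" using c nbh_subset finite_V by (intro card_mono) auto
  finally show ?thesis .
qed

lemma card_triangle_nbh:
  assumes "adj x y" "adj y z" "adj x z"
  shows "card (nbh x \<union> nbh y \<union> nbh z) = 3 * r + 6 + card (nbh x \<inter> nbh y \<inter> nbh z)"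
  using card_Un3[of "nbh x" "nbh y" "nbh z"] degree[OF adj_V[OF assms(1)]] degree[OF adj_V[OF assms(2)]]
    degree[OF adj_V2[OF assms(2)]] common_adj[OF assms(1)] common_adj[OF assms(2)] common_adj[OF assms(3)]
  by simp

text \<open>By \<open>cycle_unique\<close>, at most one common neighbour of \<open>x\<close> and
  \<open>z\<close> other than \<open>y\<close> is not adjacent to \<open>y\<close>. So the triple
  intersection has at least \<open>\<mu> - 2\<close> elements, and inclusion-exclusion gives the
  bound.\<close>

lemma card_path_nbh:
  assumes "adj x y" "adj y z" "x \<noteq> z" "\<not> adj x z"
  shows "card (nbh x \<union> nbh y \<union> nbh z) \<ge> 4 * r + \<mu> + 2"
proof -
  note y = adj_sym[OF assms(1)] assms(2,3,4)
  have "card (nbh x \<inter> nbh z) \<le> card (nbh x \<inter> nbh y \<inter> nbh z) + 2"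
  proof (cases "\<exists>w. adj x w \<and> adj z w \<and> w \<noteq> y \<and> \<not> adj y w")
    case True
    then obtain w where w: "adj x w" "adj z w" "w \<noteq> y" "\<not> adj y w" by blast
    have "nbh x \<inter> nbh z \<subseteq> insert y (insert w (nbh x \<inter> nbh y \<inter> nbh z))"
    proof
      fix v assume "v \<in> nbh x \<inter> nbh z"
      then show "v \<in> insert y (insert w (nbh x \<inter> nbh y \<inter> nbh z))"
        using cycle_unique[OF y w, of v] by auto
    qed
    then have "card (nbh x \<inter> nbh z) \<le> card (insert y (insert w (nbh x \<inter> nbh y \<inter> nbh z)))"
      by (intro card_mono) auto
    also have "\<dots> \<le> card (nbh x \<inter> nbh y \<inter> nbh z) + 2" by (simp add: card_insert_if)
    finally show ?thesis .
  next
    case False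
    then have "nbh x \<inter> nbh z \<subseteq> insert y (nbh x \<inter> nbh y \<inter> nbh z)" by auto
    then have "card (nbh x \<inter> nbh z) \<le> card (insert y (nbh x \<inter> nbh y \<inter> nbh z))"
      by (intro card_mono) auto
    also have "\<dots> \<le> card (nbh x \<inter> nbh y \<inter> nbh z) + 2" by (simp add: card_insert_if)
    finally show ?thesis .
  qed
  moreover have "x \<in> V" "y \<in> V" "z \<in> V" using assms adj_V adj_V2 by blast+
  ultimately show ?thesis
    using card_Un3[of "nbh x" "nbh y" "nbh z"] degree[of x] degree[of y] degree[of z]
      common_adj[OF assms(1)] common_adj[OF assms(2)] common_nonadj[of x z] assms
    by simp
qed

section \<open>Average degrees of the two sides of a cut\<close>

lemma gram_row_ge:
  assumes "finite X" "Y \<subseteq> X"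
  shows "gram_row v X \<ge> gram_row v Y"
  unfolding gram_row_def using assms by (intro sum_mono2) (auto simp: gram_def)

text \<open>If \<open>d\<close> is the average degree of the graph induced on \<open>A\<close>, then
  \<open>gram_sum A A = (d + 2) |A|\<close>, and the bounds amount to
  \<open>1 < d \<le> |A| - 1\<close>.\<close>

lemma small_cut_gram_sum:
  assumes "small_cut A B"
  shows "card A \<ge> 3" "gram_sum A A > 3 * int (card A)" "gram_sum A A \<le> int (card A) * (int (card A) + 1)"
proof -
  obtain x y z where xyz: "x \<in> A" "y \<in> A" "z \<in> A" "adj x y" "adj y z" "x \<noteq> z"
    by (rule small_cut_path[OF assms])
  have A: "A \<subseteq> V" "\<And>a. a \<in> A \<Longrightarrow> \<exists>a'\<in>A. adj a a'" using assms by (auto simp: small_cut_def)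
  have fA: "finite A" using A(1) by (rule finite_sub)
  have ne: "x \<noteq> y" "y \<noteq> z" using xyz adj_irrefl by auto
  have "card {x, y, z} \<le> card A" using xyz fA by (intro card_mono) auto
  then show "card A \<ge> 3" using xyz(6) ne by simp
  have g3: "gram_row v A \<ge> 3" if "v \<in> A" for v
  proof -
    obtain w where w: "w \<in> A" "adj v w" using A(2)[OF \<open>v \<in> A\<close>] by blast
    have "v \<noteq> w" using w adj_irrefl by blast
    then have "gram_row v {v, w} = 3" using w by (simp add: gram_row_def gram_adj)
    then show ?thesis using gram_row_ge[OF fA, of "{v, w}" v] that w by simp
  qed
  have "gram_row y {x, y, z} = 4" using xyz ne by (simp add: gram_row_def gram_adj gram_adj')
  then have "gram_row y A \<ge> 4" using gram_row_ge[OF fA, of "{x, y, z}" y] xyz by simp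
  moreover have "gram_sum A A = gram_row y A + (\<Sum>v\<in>A-{y}. gram_row v A)"
    unfolding gram_sum_def by (rule sum.remove[OF fA xyz(2)])
  moreover have "(\<Sum>v\<in>A-{y}. gram_row v A) \<ge> (\<Sum>v\<in>A-{y}. 3)"
    using g3 by (intro sum_mono) auto
  moreover have "int (card A) = int (card (A - {y})) + 1"
    using card.remove[OF fA xyz(2)] by simp
  ultimately show "gram_sum A A > 3 * int (card A)" by simp
  have "gram_row v A \<le> int (card A) + 1" if "v \<in> A" for v
  proof -
    have "gram_row v A = 2 + (\<Sum>w\<in>A-{v}. gram v w)" using that fA by (simp add: gram_row_def sum.remove)
    also have "(\<Sum>w\<in>A-{v}. gram v w) \<le> (\<Sum>w\<in>A-{v}. 1)" by (intro sum_mono) (auto simp: gram_def)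
    also have "2 + (\<Sum>w\<in>A-{v}. 1) = int (card A) + 1"
      using card.remove[OF fA that] by (simp del: card_Diff_insert)
    finally show ?thesis by simp
  qed
  then have "gram_sum A A \<le> (\<Sum>v\<in>A. int (card A) + 1)" unfolding gram_sum_def by (intro sum_mono)
  then show "gram_sum A A \<le> int (card A) * (int (card A) + 1)" by simp
qed

lemma gram_row_0:
  assumes "\<And>a. a \<in> A \<Longrightarrow> v \<noteq> a \<and> \<not> adj v a"
  shows "gram_row v A = 0"
  using assms by (auto simp: gram_row_def gram_def intro!: sum.neutral)

text \<open>An interlacing argument: as \<open>r\<close> is the second largest eigenvalue, two parts
  without edges between them cannot both have average degree above \<open>r\<close>. The test vector
  \<open>|B| A - |A| B\<close> has height 0.\<close>

lemma small_cut_spectral: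
  assumes "small_cut A B"
  shows "gram_sum A A \<le> (int r + 2) * int (card A) \<or> gram_sum B B \<le> (int r + 2) * int (card B)"
proof (rule ccontr)
  assume no: "\<not> ?thesis"
  have c: "A \<subseteq> V" "B \<subseteq> V" "A \<inter> B = {}" "\<And>a b. a \<in> A \<Longrightarrow> b \<in> B \<Longrightarrow> \<not> adj a b"
    using assms by (auto simp: small_cut_def)
  have fin: "finite A" "finite B" using c by (auto intro: finite_sub)
  define a b where "a = int (card A)" and "b = int (card B)"
  have ab: "a > 0" "b > 0" using assms fin by (auto simp: a_def b_def small_cut_def card_gt_0_iff)
  have z: "gram_row v B = 0" if "v \<in> A" for v using that c by (intro gram_row_0) auto
  have z': "gram_row v A = 0" if "v \<in> B" for v using that c adj_sym by (intro gram_row_0) blast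
  have gg0: "gram_sum A B = 0" "gram_sum B A = 0" using z z' by (simp_all add: gram_sum_def)
  define L where "L = [(b, A), (-a, B)]"
  have L: "supported L" "height L = 0" "form L = b\<^sup>2 * gram_sum A A + a\<^sup>2 * gram_sum B B"
    using c by (simp_all add: L_def supported_def height_def form_def a_def b_def gg0 power2_eq_square)
  have strict: "(int r + 2) * gram_sum X X < (\<Sum>v\<in>X. (gram_row v X)\<^sup>2)"
    if X: "gram_sum X X > (int r + 2) * int (card X)" "card X > 0" for X
  proof -
    have "gram_sum X X > 0"
    proof -
      have "(int r + 2) * int (card X) \<ge> 0" by simp
      then show ?thesis using X(1) by linarith
    qed
    have "int (card X) * ((int r + 2) * gram_sum X X) < gram_sum X X * gram_sum X X"
      using mult_strict_right_mono[OF X(1) \<open>gram_sum X X > 0\<close>] by (simp add: algebra_simps)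
    also have "\<dots> \<le> int (card X) * (\<Sum>v\<in>X. (gram_row v X)\<^sup>2)"
      using sum_sq_le_card_mult[of "\<lambda>v. gram_row v X" X] by (simp add: gram_sum_def power2_eq_square)
    finally show ?thesis by (simp add: mult_less_cancel_left)
  qed
  have "(\<Sum>v\<in>A \<union> B. (ev L v)\<^sup>2) \<le> (\<Sum>v\<in>V. (ev L v)\<^sup>2)"
    using c finite_V by (intro sum_mono2) auto
  moreover have "(\<Sum>v\<in>A \<union> B. (ev L v)\<^sup>2) = (\<Sum>v\<in>A. (ev L v)\<^sup>2) + (\<Sum>v\<in>B. (ev L v)\<^sup>2)"
    using fin c by (intro sum.union_disjoint) auto
  moreover have "(\<Sum>v\<in>A. (ev L v)\<^sup>2) = b\<^sup>2 * (\<Sum>v\<in>A. (gram_row v A)\<^sup>2)"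
    using z by (simp add: ev_def L_def power_mult_distrib sum_distrib_left)
  moreover have "(\<Sum>v\<in>B. (ev L v)\<^sup>2) = a\<^sup>2 * (\<Sum>v\<in>B. (gram_row v B)\<^sup>2)"
    using z' by (simp add: ev_def L_def power_mult_distrib sum_distrib_left)
  moreover have "b\<^sup>2 * ((int r + 2) * gram_sum A A) < b\<^sup>2 * (\<Sum>v\<in>A. (gram_row v A)\<^sup>2)"
    using strict[of A] no ab by (intro mult_strict_left_mono) (auto simp: a_def b_def)
  moreover have "a\<^sup>2 * ((int r + 2) * gram_sum B B) < a\<^sup>2 * (\<Sum>v\<in>B. (gram_row v B)\<^sup>2)"
    using strict[of B] no ab by (intro mult_strict_left_mono) (auto simp: a_def b_def)
  moreover have "(\<Sum>v\<in>V. (ev L v)\<^sup>2) = (int r + 2) * (b\<^sup>2 * gram_sum A A + a\<^sup>2 * gram_sum B B)"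
    using sum_ev_sq[OF L(1)] L by simp
  ultimately show False by (simp add: algebra_simps)
qed

text \<open>The inner products with \<open>A\<close> vanish on \<open>B\<close>, so their first two
  moments on the cut are those on \<open>V\<close> minus those on \<open>A\<close>. Cauchy--Schwarz
  is used twice, on the cut and, to bound the second moment there from above, on
  \<open>A\<close>.\<close>

lemma small_cut_ineq:
  assumes "small_cut A B"
  defines "a \<equiv> int (card A)" and "X \<equiv> gram_sum A A" and "s \<equiv> int (card (V - A - B))"
  shows "a * ((2 * int r + int \<mu> + 2) * a - X)\<^sup>2 \<le> s * (X * ((int r + 2) * a - X) + int \<mu> * a ^ 3)"
    "s < 3 * int r + int \<mu>" "int (card V) = a + int (card B) + s"
proof -
  have c: "A \<subseteq> V" "B \<subseteq> V" "A \<inter> B = {}" "\<And>a b. a \<in> A \<Longrightarrow> b \<in> B \<Longrightarrow> \<not> adj a b"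
    using assms by (auto simp: small_cut_def)
  have fin: "finite A" "finite B" using c by (auto intro: finite_sub)
  define S where "S = V - A - B"
  have V: "V = A \<union> B \<union> S" "(A \<union> B) \<inter> S = {}" "finite S" using c finite_V by (auto simp: S_def)
  have cV: "card V = card A + card B + card S"
    using V fin c by (metis card_Un_disjoint finite_Un)
  then show "s < 3 * int r + int \<mu>" "int (card V) = a + int (card B) + s"
    using assms(1) by (simp_all add: s_def S_def small_cut_def a_def)
  have z': "gram_row v A = 0" if "v \<in> B" for v using that c adj_sym by (intro gram_row_0) blast
  have split: "(\<Sum>v\<in>V. f (gram_row v A)) = (\<Sum>v\<in>A. f (gram_row v A)) + (\<Sum>v\<in>S. f (gram_row v A))"
    if "f 0 = 0" for f :: "int \<Rightarrow> int"
  proof -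
    have "(\<Sum>v\<in>V. f (gram_row v A)) = (\<Sum>v\<in>A \<union> B. f (gram_row v A)) + (\<Sum>v\<in>S. f (gram_row v A))"
      using V fin by (subst V(1)) (intro sum.union_disjoint, auto)
    also have "(\<Sum>v\<in>A \<union> B. f (gram_row v A)) = (\<Sum>v\<in>A. f (gram_row v A)) + (\<Sum>v\<in>B. f (gram_row v A))"
      using fin c by (intro sum.union_disjoint) auto
    finally show ?thesis using that z' by simp
  qed
  have e1: "(\<Sum>v\<in>S. gram_row v A) = (2 * int r + int \<mu> + 2) * a - X"
    using split[of "\<lambda>i. i"] sum_gram_row[OF c(1)] by (simp add: X_def a_def gram_sum_def)
  have "(\<Sum>v\<in>V. (gram_row v A)\<^sup>2) = (int r + 2) * X + int \<mu> * a\<^sup>2"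
    using sum_gram_row_gram_row[OF c(1) c(1)] by (simp add: X_def a_def power2_eq_square)
  then have e2: "(\<Sum>v\<in>S. (gram_row v A)\<^sup>2) = (int r + 2) * X + int \<mu> * a\<^sup>2 - (\<Sum>v\<in>A. (gram_row v A)\<^sup>2)"
    using split[of "\<lambda>i. i\<^sup>2"] by simp
  have "X\<^sup>2 \<le> a * (\<Sum>v\<in>A. (gram_row v A)\<^sup>2)"
    using sum_sq_le_card_mult[of "\<lambda>v. gram_row v A" A] by (simp add: X_def a_def gram_sum_def)
  then have "a * (\<Sum>v\<in>S. (gram_row v A)\<^sup>2) \<le> X * ((int r + 2) * a - X) + int \<mu> * a ^ 3"
    unfolding e2 by (simp add: power2_eq_square power3_eq_cube algebra_simps)
  then have "s * (a * (\<Sum>v\<in>S. (gram_row v A)\<^sup>2)) \<le> s * (X * ((int r + 2) * a - X) + int \<mu> * a ^ 3)"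
    by (intro mult_left_mono) (simp_all add: s_def)
  moreover have "((2 * int r + int \<mu> + 2) * a - X)\<^sup>2 \<le> s * (\<Sum>v\<in>S. (gram_row v A)\<^sup>2)"
    using sum_sq_le_card_mult[of "\<lambda>v. gram_row v A" S] unfolding e1 by (simp add: s_def flip: S_def)
  then have "a * ((2 * int r + int \<mu> + 2) * a - X)\<^sup>2 \<le> a * (s * (\<Sum>v\<in>S. (gram_row v A)\<^sup>2))"
    by (intro mult_left_mono) (simp_all add: a_def)
  ultimately show "a * ((2 * int r + int \<mu> + 2) * a - X)\<^sup>2 \<le> s * (X * ((int r + 2) * a - X) + int \<mu> * a ^ 3)"
    by (simp add: algebra_simps)
qed

text \<open>With \<open>d\<close> the average degree of \<open>A\<close>, the bound of \<open>small_cut_ineq\<close> is tight only for triangles.\<close>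

lemma small_cut_triangle:
  assumes cut: "small_cut A B" and X: "gram_sum A A \<le> (int r + 2) * int (card A)"
    and par: "\<mu> = 2 \<or> \<mu> = 4 \<or> \<mu> = 3 \<and> r = 3"
  shows "\<mu> = 4 \<and> card A = 3 \<and> gram_sum A A = 12 \<and> card V = card B + 3 * r + 6"
proof -
  define a where "a = real (card A)"
  define d where "d = real_of_int (gram_sum A A) / a - 2"
  define s where "s = real (card (V - A - B))"
  define R where "R = real r"
  define m where "m = real \<mu>"
  note ggs = small_cut_gram_sum[OF cut] and ineq = small_cut_ineq[OF cut]
  have a3: "a \<ge> 3" using ggs(1) by (simp add: a_def)
  have X': "real_of_int (gram_sum A A) = (d + 2) * a" using a3 by (simp add: d_def)
  have "real_of_int (gram_sum A A) > real_of_int (3 * int (card A))" using ggs(2) by (simp only: of_int_less_iff)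
  then have d1: "d > 1" using a3 by (simp add: X' a_def[symmetric])
  have "real_of_int (gram_sum A A) \<le> real_of_int (int (card A) * (int (card A) + 1))"
    using ggs(3) by (simp only: of_int_le_iff)
  then have da: "d \<le> a - 1" using a3 by (simp add: X' a_def[symmetric])
  have "real_of_int (gram_sum A A) \<le> real_of_int ((int r + 2) * int (card A))"
    using X by (simp only: of_int_le_iff)
  then have dr: "d \<le> R" using a3 by (simp add: X' a_def[symmetric] R_def)
  have s: "s \<le> 3 * R + m - 1" using ineq(2) unfolding s_def R_def m_def by linarith
  define Y where "Y = (d + 2) * (R - d) + m * a"
  have "real_of_int (int (card A) * ((2 * int r + int \<mu> + 2) * int (card A) - gram_sum A A)\<^sup>2) \<le>
    real_of_int (int (card (V - A - B)) * (gram_sum A A * ((int r + 2) * int (card A) - gram_sum A A) + int \<mu> * int (card A) ^ 3))"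
    using ineq(1) by (simp only: of_int_le_iff)
  then have "a * ((2 * R + m + 2) * a - (d + 2) * a)\<^sup>2 \<le> s * ((d + 2) * a * ((R + 2) * a - (d + 2) * a) + m * a ^ 3)"
    by (simp add: X' a_def[symmetric] R_def m_def s_def)
  then have "a\<^sup>2 * (a * (2 * R + m - d)\<^sup>2) \<le> a\<^sup>2 * (s * Y)"
    by (simp add: Y_def power2_eq_square power3_eq_cube algebra_simps)
  then have main: "a * (2 * R + m - d)\<^sup>2 \<le> s * Y"
    using a3 by (simp add: mult_le_cancel_left)
  have m0: "m > 0" using mu_pos by (simp add: m_def)
  have Y0: "Y > 0" unfolding Y_def using d1 dr a3 m0 by (intro add_nonneg_pos mult_nonneg_nonneg mult_pos_pos) auto
  \<comment> \<open>Inserting the largest admissible \<open>s\<close>, namely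
    \<open>3R + m - 1\<close>, turns the inequality into \<open>P \<le> 0\<close>. In each case
    \<open>P\<close> is rewritten so that \<open>a \<ge> 3\<close>, \<open>d \<le> a - 1\<close> and
    \<open>d \<le> R\<close> determine its sign.\<close>
  define P where "P = a * (2 * R + m - d)\<^sup>2 - (3 * R + m - 1) * Y"
  have "s * Y \<le> (3 * R + m - 1) * Y" using s Y0 by (intro mult_right_mono) auto
  then have P0: "P \<le> 0" using main by (simp add: P_def)
  have m4: "m = 4"
  proof (rule ccontr)
    assume "m \<noteq> 4"
    then consider "m = 2" | "m = 3" "R = 3" using par by (auto simp: m_def R_def)
    then show False
    proof cases
      case 1
      have "P = a * ((d - 1)\<^sup>2 + 1) + (R - d) * ((4 * R + 2) * a - (3 * R + 1) * (d + 2))"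
        unfolding P_def Y_def 1 by (simp add: power2_eq_square algebra_simps)
      moreover have "(4 * R + 2) * a - (3 * R + 1) * (d + 2) \<ge> 0"
      proof (cases "d \<ge> 2")
        case True
        have "(4 * R + 2) * a \<ge> (4 * R + 2) * (d + 1)" using da dr d1 by (intro mult_left_mono) auto
        moreover have "(4 * R + 2) * (d + 1) - (3 * R + 1) * (d + 2) = R * (d - 2) + d"
          by (simp add: algebra_simps)
        moreover have "R * (d - 2) \<ge> 0" using True dr by (intro mult_nonneg_nonneg) auto
        ultimately show ?thesis using d1 by linarith
      next
        case False
        have "(4 * R + 2) * a \<ge> (4 * R + 2) * 3" using a3 dr d1 by (intro mult_left_mono) auto
        moreover have "(3 * R + 1) * (d + 2) \<le> (3 * R + 1) * 4" using False dr d1 by (intro mult_left_mono) auto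
        ultimately show ?thesis by (simp add: algebra_simps)
      qed
      moreover have "a * ((d - 1)\<^sup>2 + 1) > 0" using a3 by (intro mult_pos_pos) (auto intro: add_nonneg_pos)
      ultimately show False using P0 dr by (smt (verit) mult_nonneg_nonneg)
    next
      case 2
      \<comment> \<open>The pair \<open>\<mu> = r = 3\<close> comes from claws. When
        \<open>a = 3\<close>, integrality leaves the values 10, 11, 12 of
        \<open>gram_sum A A\<close>, which are checked one by one.\<close>
      define e where "e = 3 - d"
      have e: "e \<ge> 0" using dr 2 by (simp add: e_def)
      have P: "P = 3 * a + e * (12 * a + a * e - 55 + 11 * e)"
        unfolding P_def Y_def 2 e_def by (simp add: power2_eq_square algebra_simps)
      have "P > 0"
      proof (cases "a \<ge> 4")
        case True
        have "a * (3 + 12 * e + e * e) \<ge> 4 * (3 + 12 * e + e * e)"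
          using True e by (intro mult_right_mono) auto
        moreover have "12 + e * (15 * e - 7) > 0"
        proof -
          have "12 + e * (15 * e - 7) = 15 * (e - 7 / 30)\<^sup>2 + (12 - 49 / 60)"
            by (simp add: power2_eq_square algebra_simps)
          then show ?thesis by (simp add: add_nonneg_pos)
        qed
        ultimately show ?thesis unfolding P by (simp add: algebra_simps)
      next
        case False
        then have "card A = 3" using ggs(1) by (simp add: a_def)
        then have "gram_sum A A > 9" "gram_sum A A \<le> 12" "a = 3" using ggs by (simp_all add: a_def)
        then consider "gram_sum A A = 10" | "gram_sum A A = 11" | "gram_sum A A = 12" by linarith
        then show ?thesis unfolding P e_def d_def \<open>a = 3\<close> by cases simp_all
      qed
      then show False using P0 by simp
    qed
  qed
  \<comment> \<open>As \<open>d \<le> a - 1\<close>, the last factor of the product is at least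
    \<open>a - 3\<close>. So \<open>P \<le> 0\<close> forces \<open>d = 2\<close>, and also
    \<open>a = 3\<close> unless \<open>R = 2\<close>.\<close>
  have P: "P = (R + 1) * (R - d) * (4 * a - 6 - 3 * d) + a * (d - 2)\<^sup>2"
    unfolding P_def Y_def m4 by (simp add: power2_eq_square algebra_simps)
  have pos: "4 * a - 6 - 3 * d \<ge> 0" using a3 da by linarith
  have n1: "(R + 1) * (R - d) * (4 * a - 6 - 3 * d) \<ge> 0"
    using pos dr d1 by (intro mult_nonneg_nonneg) auto
  have n2: "a * (d - 2)\<^sup>2 \<ge> 0" using a3 by simp
  have "a * (d - 2)\<^sup>2 = 0" "(R + 1) * (R - d) * (4 * a - 6 - 3 * d) = 0" using P P0 n1 n2 by linarith+
  then have d2: "d = 2" and ra: "R = 2 \<or> a = 3" using a3 dr d1 by auto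
  have "P = 0" using P \<open>a * (d - 2)\<^sup>2 = 0\<close> \<open>(R + 1) * (R - d) * (4 * a - 6 - 3 * d) = 0\<close> by simp
  then have "(3 * R + m - 1) * Y \<le> s * Y" using main by (simp add: P_def)
  then have "s \<ge> 3 * R + 3" using Y0 m4 by simp
  then have s: "card (V - A - B) = 3 * r + 3" using s m4 by (simp add: s_def R_def)
  have mu: "\<mu> = 4" using m4 by (simp add: m_def)
  have cV: "card V = card A + card B + (3 * r + 3)" using ineq(3) s by simp
  have "card A = 3"
  proof (cases "a = 3")
    case False
    \<comment> \<open>The graph now has 15 vertices, 9 of them in the cut, and each side has at
      least 3, so \<open>A\<close> is left with exactly 3.\<close>
    then have r: "r = 2" using ra by (simp add: R_def)
    have "V \<noteq> {}" using cut by (auto simp: small_cut_def)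
    then have "card V = 15" using card_V r mu by simp
    then show ?thesis using cV r small_cut_gram_sum(1)[OF cut] small_cut_gram_sum(1)[OF small_cut_commute[OF cut]] by simp
  qed (simp add: a_def)
  moreover have "gram_sum A A = 12" using X' d2 \<open>card A = 3\<close> by (simp add: a_def)
  ultimately show ?thesis using mu cV by simp
qed

lemma small_cut_r_ge_2:
  assumes "small_cut A B"
  shows "r \<ge> 2"
proof -
  have *: "r \<ge> 2" if "small_cut A B" "gram_sum A A \<le> (int r + 2) * int (card A)" for A B
  proof -
    have "3 * int (card A) < (int r + 2) * int (card A)" using small_cut_gram_sum(2)[OF that(1)] that(2) by linarith
    then have "3 < int r + 2" by (simp add: mult_less_cancel_right)
    then show ?thesis by simp
  qed
  show ?thesis
    using small_cut_spectral[OF assms] *[OF assms] *[OF small_cut_commute[OF assms]] by blast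
qed

text \<open>\<open>B\<close> avoids the \<open>3r + 6 + t\<close> neighbours of the triangle
  \<open>A\<close>, where \<open>t\<close> counts the common neighbours of its three vertices; as
  \<open>|V| = |B| + 3r + 6\<close>, \<open>t = 0\<close>. By \<open>triangle_count\<close> with
  \<open>\<mu> = 4\<close>, no outside vertex is then adjacent to exactly one of the three.\<close>

lemma small_cut_triangle_cases:
  assumes "small_cut A B" "\<mu> = 2 \<or> \<mu> = 4 \<or> \<mu> = 3 \<and> r = 3"
  obtains x y z where "\<mu> = 4" "adj x y" "adj y z" "adj x z"
    "co_nbh x y \<inter> co_nbh x z = {}" "co_nbh y x \<inter> co_nbh y z = {}" "co_nbh z x \<inter> co_nbh z y = {}"
    "nbh x \<inter> nbh y \<inter> nbh z = {}"
proof -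
  have "\<exists>A B. small_cut A B \<and> gram_sum A A \<le> (int r + 2) * int (card A)"
    using small_cut_spectral[OF assms(1)] assms(1) small_cut_commute by blast
  then obtain A B where cut: "small_cut A B" and X: "gram_sum A A \<le> (int r + 2) * int (card A)" by blast
  have tri: "\<mu> = 4" "card A = 3" "gram_sum A A = 12" "card V = card B + 3 * r + 6"
    using small_cut_triangle[OF cut X assms(2)] by auto
  obtain x y z where xyz: "x \<in> A" "y \<in> A" "z \<in> A" "adj x y" "adj y z" "x \<noteq> z"
    by (rule small_cut_path[OF cut])
  have ne: "x \<noteq> y" "y \<noteq> z" using xyz adj_irrefl by auto
  have "finite A" using tri(2) by (metis card.infinite zero_neq_numeral)
  then have A: "A = {x, y, z}"
    using xyz ne tri(2) card_subset_eq[of A "{x, y, z}"] by simp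
  have "gram_sum A A = 10 + 2 * gram x z"
    using xyz ne by (simp add: A gram_sum_def gram_row_def gram_adj gram_adj' gram_commute[of z x])
  then have "gram x z = 1" using tri(3) by simp
  then have xz: "adj x z" by (auto simp: gram_def split: if_splits)
  have t: "card (nbh x \<inter> nbh y \<inter> nbh z) = 0"
    using small_cut_far[OF cut xyz(1-3)] card_triangle_nbh[OF xyz(4,5) xz] tri(4) by simp
  have perm: "nbh y \<inter> nbh x \<inter> nbh z = nbh x \<inter> nbh y \<inter> nbh z" "nbh z \<inter> nbh x \<inter> nbh y = nbh x \<inter> nbh y \<inter> nbh z"
    by blast+
  have "card (co_nbh x y \<inter> co_nbh x z) = 0" "card (co_nbh y x \<inter> co_nbh y z) = 0" "card (co_nbh z x \<inter> co_nbh z y) = 0"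
    using triangle_count[OF xyz(4) xz xyz(5)] triangle_count[OF adj_sym[OF xyz(4)] xyz(5) xz]
      triangle_count[OF adj_sym[OF xz] adj_sym[OF xyz(5)] xyz(4)] t tri(1) unfolding perm by simp_all
  then show ?thesis using that[OF tri(1) xyz(4,5) xz] t by simp
qed

lemma small_cut_triangular:
  assumes cut: "small_cut A B"
    and conn: "\<And>P. P \<subseteq> V \<Longrightarrow> P \<noteq> {} \<Longrightarrow> (\<And>a b. a \<in> P \<Longrightarrow> adj a b \<Longrightarrow> b \<in> P) \<Longrightarrow> P = V"
  shows "\<exists>g :: 'a \<Rightarrow> nat set. bij_betw g V {A. A \<subseteq> {1..r + 4} \<and> card A = 2} \<and>
    (\<forall>a\<in>V. \<forall>b\<in>V. adj a b \<longleftrightarrow> card (g a \<inter> g b) = 1)"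
proof -
  have r2: "r \<ge> 2" using small_cut_r_ge_2[OF cut] .
  have Vne: "V \<noteq> {}" using cut by (auto simp: small_cut_def)
  show ?thesis
  proof (cases "\<exists>c p q s. claw c p q s")
    case True
    then obtain c p q s where claw: "claw c p q s" by blast
    have "\<mu> = 2 \<or> \<mu> = 4 \<or> \<mu> = 3 \<and> r = 3"
      using claw_mu[OF claw] claw_r_le_4[OF claw] r2 by auto
    then obtain x y z where xyz: "adj x y" "adj y z" "adj x z"
      and h: "co_nbh x y \<inter> co_nbh x z = {}" "co_nbh y x \<inter> co_nbh y z = {}" "co_nbh z x \<inter> co_nbh z y = {}"
      and t: "nbh x \<inter> nbh y \<inter> nbh z = {}"
      using small_cut_triangle_cases[OF cut] by metis
    have ne: "x \<noteq> y" "y \<noteq> z" "x \<noteq> z" using xyz adj_irrefl by auto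
    have "even (gram w x + gram w y + gram w z)" for w
    proof (cases "w \<in> {x, y, z}")
      case True
      then show ?thesis using xyz ne by (auto simp: gram_adj gram_adj')
    next
      case False
      have "\<not> (adj x w \<and> adj y w \<and> adj z w)" using t by blast
      moreover have "adj x w \<longrightarrow> adj y w \<or> adj z w" "adj y w \<longrightarrow> adj x w \<or> adj z w" "adj z w \<longrightarrow> adj x w \<or> adj y w"
        using h False by (auto simp: co_nbh_def)
      ultimately show ?thesis using False by (auto simp: gram_def adj_commute[of w])
    qed
    then have False
      using claw_no_even_triangle[OF claw adj_V[OF xyz(1)] adj_V[OF xyz(2)] adj_V2[OF xyz(2)]] by blast
    then show ?thesis ..
  next
    case False
    interpret srg_no_claw V adj r \<mu> by unfold_locales (use False in blast)
    have "\<mu> \<le> 4"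
    proof (rule ccontr)
      assume "\<not> \<mu> \<le> 4"
      then have mu: "\<mu> = r + 4" "r \<le> 4"
        and h: "\<And>z x u. adj z x \<Longrightarrow> adj z u \<Longrightarrow> adj x u \<Longrightarrow> 2 * card (co_nbh z x \<inter> co_nbh z u) = r"
        using large_mu r2 Vne by auto
      \<comment> \<open>Three vertices of one side forming a path or triangle have at least
        \<open>3r + \<mu> + 2 + r / 2\<close> neighbours, all outside the other side. Used for both
        sides, this gives \<open>|V| \<ge> 5r + 9\<close>, whereas
        \<open>(r + 4) |V| = 6 (r + 2)^2\<close> and \<open>r \<le> 4\<close>.\<close>
      have far: "2 * card B' + 2 * (3 * r + \<mu> + 2) + r \<le> 2 * card V" if cut': "small_cut A' B'" for A' B'
      proof -
        obtain x y z where xyz: "x \<in> A'" "y \<in> A'" "z \<in> A'" "adj x y" "adj y z" "x \<noteq> z"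
          by (rule small_cut_path[OF cut'])
        have "2 * card (nbh x \<union> nbh y \<union> nbh z) \<ge> 2 * (3 * r + \<mu> + 2) + r"
        proof (cases "adj x z")
          case True
          show ?thesis
            using card_triangle_nbh[OF xyz(4,5) True] triangle_count[OF xyz(4) True xyz(5)] h[OF xyz(4) True xyz(5)] by simp
        next
          case False
          show ?thesis using card_path_nbh[OF xyz(4,5,6) False] by simp
        qed
        then show ?thesis using small_cut_far[OF cut' xyz(1-3)] by simp
      qed
      have "card V < card A + card B + 3 * r + \<mu>" using cut by (simp add: small_cut_def)
      then have "5 * r + 9 \<le> card V" using far[OF cut] far[OF small_cut_commute[OF cut]] mu by simp
      then have "(int r + 4) * (5 * int r + 9) \<le> (int r + 4) * int (card V)"
        by (intro mult_left_mono) linarith+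
      then have "int r * int r - 5 * int r - 12 \<ge> 0"
        using card_V[OF Vne] mu(1) by (simp add: algebra_simps)
      moreover have "int r * int r \<le> 4 * int r" using mu(2) by (intro mult_right_mono) auto
      ultimately show False by simp
    qed
    moreover have "even \<mu>"
    proof -
      obtain z where z: "z \<in> V" using Vne by blast
      then have "card (nbh z) \<noteq> 0" using degree mu_pos by simp
      then obtain x where zx: "adj z x" by fastforce
      have "card (co_nbh z x) \<noteq> 0" using card_co_nbh[OF zx] by simp
      then obtain y where y: "y \<in> co_nbh z x" by fastforce
      have zy: "adj z y" using y by (simp add: co_nbh_def)
      have "x \<in> co_nbh z y" using co_nbh_commute[OF zx zy] y by simp
      then have "card (co_nbh z y - {x}) \<noteq> 0" using card_co_nbh[OF zy] r2 by simp
      then have "co_nbh z y - {x} \<noteq> {}" by (metis card.empty)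
      then obtain u where "u \<in> co_nbh z y" "u \<noteq> x" by blast
      then have "2 * card {p \<in> common z x y. \<not> adj u p} + 2 = \<mu>"
        by (rule card_common_nonadj[OF zx y])
      then show ?thesis by presburger
    qed
    ultimately have "\<mu> = 2 \<or> \<mu> = 4 \<or> \<mu> = 3 \<and> r = 3" using mu_pos by presburger
    then obtain x y z where mu4: "\<mu> = 4" and xyz: "adj x y" "adj x z" "adj y z" "co_nbh x y \<inter> co_nbh x z = {}"
      using small_cut_triangle_cases[OF cut] by metis
    have "r \<ge> 1" using r2 by simp
    obtain g :: "'a \<Rightarrow> nat set" where "bij_betw g V {A. A \<subseteq> {1..r + 4} \<and> card A = 2}"
      "\<And>a b. a \<in> V \<Longrightarrow> b \<in> V \<Longrightarrow> adj a b \<longleftrightarrow> card (g a \<inter> g b) = 1"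
      by (rule triangular[OF mu4 \<open>r \<ge> 1\<close> xyz]) (use conn in blast)+
    then show ?thesis by blast
  qed
qed

end

section \<open>Digraphs and triangular graphs\<close>

lemma graph_eigenvalueE:
  assumes "graph_eigenvalue G \<theta>"
  obtains g :: "'a \<Rightarrow> real" and x where "x \<in> verts G" "g x \<noteq> 0"
    "\<And>x. x \<in> verts G \<Longrightarrow> (\<Sum>y\<in>neighbors G x. g y) = \<theta> * g x"
proof -
  obtain vs where vs: "distinct vs" "set vs = verts G" "eigenvalue (adjacency_mat G vs) \<theta>"
    using assms by (auto simp: graph_eigenvalue_def)
  define n where "n = length vs"
  obtain w where w: "w \<in> carrier_vec n" "w \<noteq> 0\<^sub>v n" "adjacency_mat G vs *\<^sub>v w = \<theta> \<cdot>\<^sub>v w"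
    using vs(3) by (auto simp: eigenvalue_def eigenvector_def adjacency_mat_def n_def)
  have bij: "bij_betw (nth vs) {..<n} (verts G)"
    using bij_betw_nth[OF vs(1), of "{..<n}" "verts G"] vs(2) by (simp add: n_def)
  define g where "g x = w $ the_inv_into {..<n} (nth vs) x" for x
  have g: "g (vs ! i) = w $ i" if "i < n" for i
    using that bij by (simp add: g_def the_inv_into_f_f bij_betw_def)
  obtain i where i: "i < n" "w $ i \<noteq> 0"
    using w(1,2) by (metis carrier_vecD eq_vecI index_zero_vec)
  show ?thesis
  proof (rule that[of "vs ! i" g])
    show "vs ! i \<in> verts G" using nth_mem[of i vs] i(1) vs(2) by (simp add: n_def)
    show "g (vs ! i) \<noteq> 0" using g i by simp
  next
    fix x assume "x \<in> verts G"
    then have "x \<in> set vs" using vs(2) by simp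
    then obtain i where i: "i < n" "x = vs ! i" by (auto simp: n_def in_set_conv_nth)
    have "\<theta> * g x = (adjacency_mat G vs *\<^sub>v w) $ i" using w(1,3) i g by simp
    also have "\<dots> = (\<Sum>j<n. (if x \<rightarrow>\<^bsub>G\<^esub> vs ! j then 1 else 0) * g (vs ! j))"
      using w(1) i g
      by (simp add: adjacency_mat_def n_def[symmetric] scalar_prod_def lessThan_atLeast0[symmetric])
    also have "\<dots> = (\<Sum>y\<in>verts G. (if x \<rightarrow>\<^bsub>G\<^esub> y then 1 else 0) * g y)"
      by (rule sum.reindex_bij_betw[OF bij])
    also have "\<dots> = (\<Sum>y\<in>verts G. if y \<in> neighbors G x then g y else 0)"
      by (intro sum.cong) (auto simp: neighbors_def)
    also have "\<dots> = (\<Sum>y\<in>neighbors G x. g y)"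
    proof -
      have "finite (verts G)" using vs(2) by (metis List.finite_set)
      moreover have "verts G \<inter> neighbors G x = neighbors G x" by (auto simp: neighbors_def)
      ultimately show ?thesis using sum.inter_restrict[of "verts G" g "neighbors G x"] by simp
    qed
    finally show "(\<Sum>y\<in>neighbors G x. g y) = \<theta> * g x" by simp
  qed
qed

text \<open>Apply \<open>A^2 = kI + lA + \<mu>(J - I - A)\<close> to an eigenvector \<open>g\<close>
  for -2. Its entries sum to 0 because \<open>-2 \<noteq> k\<close>, so cancelling a nonzero entry
  leaves \<open>4 = (k - \<mu>) - 2 (l - \<mu>)\<close>.\<close>

lemma srg_eigenvalue_neg2:
  assumes "srg G v k l \<mu>" "graph_eigenvalue G (-2)"
  shows "k + \<mu> = 2 * l + 4"
proof -
  interpret graph G using assms(1) by (simp add: srg_def)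
  have deg: "\<And>x. x \<in> verts G \<Longrightarrow> card (neighbors G x) = k"
    and adj: "\<And>x y. x \<in> verts G \<Longrightarrow> y \<in> verts G \<Longrightarrow> x \<rightarrow>\<^bsub>G\<^esub> y \<Longrightarrow> card (neighbors G x \<inter> neighbors G y) = l"
    and nonadj: "\<And>x y. x \<in> verts G \<Longrightarrow> y \<in> verts G \<Longrightarrow> x \<noteq> y \<Longrightarrow> \<not> x \<rightarrow>\<^bsub>G\<^esub> y \<Longrightarrow>
        card (neighbors G x \<inter> neighbors G y) = \<mu>"
    using assms(1) by (auto simp: srg_def)
  obtain g :: "'a \<Rightarrow> real" and x where x: "x \<in> verts G" "g x \<noteq> 0"
    and g: "\<And>x. x \<in> verts G \<Longrightarrow> (\<Sum>y\<in>neighbors G x. g y) = -2 * g x"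
    using graph_eigenvalueE[OF assms(2)] by metis
  have two: "(\<Sum>y\<in>A. \<Sum>w\<in>neighbors G y. g w) = (\<Sum>w\<in>verts G. card (A \<inter> neighbors G w) * g w)"
    if "A \<subseteq> verts G" for A
  proof -
    have "(\<Sum>y\<in>A. \<Sum>w\<in>neighbors G y. g w) = (\<Sum>y\<in>A. \<Sum>w\<in>{w \<in> verts G. y \<rightarrow>\<^bsub>G\<^esub> w}. g w)"
      by (simp add: neighbors_def)
    also have "\<dots> = (\<Sum>w\<in>verts G. \<Sum>y\<in>{y \<in> A. y \<rightarrow>\<^bsub>G\<^esub> w}. g w)"
      using finite_subset[OF that] by (intro sum.swap_restrict) auto
    also have "\<dots> = (\<Sum>w\<in>verts G. card (A \<inter> neighbors G w) * g w)"
    proof (rule sum.cong[OF refl])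
      fix w
      have "{y \<in> A. y \<rightarrow>\<^bsub>G\<^esub> w} = A \<inter> neighbors G w"
        using that graph_symmetric by (auto simp: neighbors_def)
      then show "(\<Sum>y\<in>{y \<in> A. y \<rightarrow>\<^bsub>G\<^esub> w}. g w) = card (A \<inter> neighbors G w) * g w" by simp
    qed
    finally show ?thesis .
  qed
  have nV: "verts G \<inter> neighbors G w = neighbors G w" for w by (auto simp: neighbors_def)
  have "(\<Sum>y\<in>verts G. -2 * g y) = (\<Sum>w\<in>verts G. k * g w)"
    using two[of "verts G"] g deg by (simp add: nV)
  then have "-2 * (\<Sum>y\<in>verts G. g y) = k * (\<Sum>y\<in>verts G. g y)"
    by (simp only: sum_distrib_left)
  then have "(real k + 2) * (\<Sum>y\<in>verts G. g y) = 0" by (simp add: algebra_simps)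
  then have s0: "(\<Sum>y\<in>verts G. g y) = 0" by (simp add: add_eq_0_iff)
  have "(\<Sum>y\<in>neighbors G x. \<Sum>w\<in>neighbors G y. g w) = (\<Sum>y\<in>neighbors G x. -2 * g y)"
    using g by (intro sum.cong) (auto simp: neighbors_def)
  also have "\<dots> = -2 * (\<Sum>y\<in>neighbors G x. g y)"
    by (rule sum_distrib_left[symmetric])
  also have "\<dots> = 4 * g x" using g[OF x(1)] by simp
  finally have "4 * g x = (\<Sum>w\<in>verts G. card (neighbors G x \<inter> neighbors G w) * g w)"
    using two[of "neighbors G x"] by (simp add: neighbors_def)
  also have "\<dots> = (\<Sum>w\<in>verts G. \<mu> * g w + (if w = x then (real k - \<mu>) * g w else 0)
      + (if w \<in> neighbors G x then (real l - \<mu>) * g w else 0))"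
  proof (rule sum.cong[OF refl])
    fix w assume w: "w \<in> verts G"
    consider "w = x" | "x \<rightarrow>\<^bsub>G\<^esub> w" "w \<noteq> x" | "\<not> x \<rightarrow>\<^bsub>G\<^esub> w" "w \<noteq> x" by blast
    then show "card (neighbors G x \<inter> neighbors G w) * g w = \<mu> * g w + (if w = x then (real k - \<mu>) * g w else 0)
      + (if w \<in> neighbors G x then (real l - \<mu>) * g w else 0)"
    proof cases
      case 1
      then show ?thesis using deg[OF x(1)] adj_not_same by (auto simp: neighbors_def algebra_simps)
    next
      case 2
      then show ?thesis using adj[OF x(1) w] w by (auto simp: neighbors_def algebra_simps)
    next
      case 3
      then show ?thesis using nonadj[OF x(1) w] w by (auto simp: neighbors_def)
    qed
  qed
  also have "\<dots> = \<mu> * (\<Sum>w\<in>verts G. g w) + (real k - \<mu>) * g x + (real l - \<mu>) * (\<Sum>w\<in>neighbors G x. g w)"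
  proof -
    have "(\<Sum>w\<in>verts G. if w \<in> neighbors G x then (real l - \<mu>) * g w else 0) = (\<Sum>w\<in>neighbors G x. (real l - \<mu>) * g w)"
      using nV[of x] by (subst sum.inter_restrict[symmetric]) simp_all
    then show ?thesis using x(1) by (simp add: sum.distrib sum_distrib_left sum.delta)
  qed
  also have "\<dots> = (real k + real \<mu> - 2 * real l) * g x" using s0 g[OF x(1)] by (simp add: algebra_simps)
  finally have "4 = real k + real \<mu> - 2 * real l" using x(2) by simp
  then show ?thesis by linarith
qed

lemma (in graph) connected_closed:
  assumes "Digraph_Component.connected G" "P \<subseteq> verts G" "P \<noteq> {}"
    and "\<And>a b. a \<in> P \<Longrightarrow> a \<rightarrow>\<^bsub>G\<^esub> b \<Longrightarrow> b \<in> P"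
  shows "P = verts G"
proof -
  have sc: "strongly_connected G"
    using symmetric_connected_imp_strongly_connected[OF sym_arcs assms(1)] .
  obtain a where a: "a \<in> P" using assms(3) by blast
  have "b \<in> P" if "b \<in> verts G" for b
  proof -
    have "a \<rightarrow>\<^sup>*\<^bsub>G\<^esub> b" using sc a assms(2) that by (auto simp: strongly_connected_def)
    then show ?thesis by (induction rule: reachable_induct) (use a assms(4) in auto)
  qed
  then show ?thesis using assms(2) by blast
qed

section \<open>Isomorphisms with triangular graphs as bijections on vertices\<close>

lemma (in graph) digraph_iso_triangular_graph:
  assumes "bij_betw g (verts G) {A. A \<subseteq> {1..m} \<and> card A = 2}"
    and adj: "\<And>a b. a \<in> verts G \<Longrightarrow> b \<in> verts G \<Longrightarrow> a \<rightarrow>\<^bsub>G\<^esub> b \<longleftrightarrow> card (g a \<inter> g b) = 1"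
  shows "digraph_iso G (triangular_graph m)"
proof -
  define f where "f = \<lparr>iso_verts = g, iso_arcs = \<lambda>e. (g (tail G e), g (head G e)), iso_head = snd, iso_tail = fst\<rparr>"
  have g: "inj_on g (verts G)" "g ` verts G = {A. A \<subseteq> {1..m} \<and> card A = 2}"
    using assms(1) by (auto simp: bij_betw_def)
  have "inj_on (iso_arcs f) (arcs G)"
  proof (rule inj_onI)
    fix e e' assume e: "e \<in> arcs G" "e' \<in> arcs G" "iso_arcs f e = iso_arcs f e'"
    then have "tail G e = tail G e'" "head G e = head G e'"
      using g(1) by (auto simp: f_def inj_on_eq_iff)
    then show "e = e'" using no_multi_arcs[OF e(1,2)] by (simp add: arc_to_ends_def)
  qed
  then have "digraph_isomorphism f"
    using g(1) wf_digraph by (simp add: digraph_isomorphism_def f_def)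
  moreover have "iso_arcs f ` arcs G = {(A, B). A \<in> g ` verts G \<and> B \<in> g ` verts G \<and> card (A \<inter> B) = 1}"
  proof (intro equalityI subsetI)
    fix p assume "p \<in> iso_arcs f ` arcs G"
    then obtain e where e: "e \<in> arcs G" "p = (g (tail G e), g (head G e))" by (auto simp: f_def)
    have "tail G e \<rightarrow>\<^bsub>G\<^esub> head G e" using e(1) by (auto simp: arcs_ends_conv)
    then show "p \<in> {(A, B). A \<in> g ` verts G \<and> B \<in> g ` verts G \<and> card (A \<inter> B) = 1}"
      using adj e by auto
  next
    fix p assume "p \<in> {(A, B). A \<in> g ` verts G \<and> B \<in> g ` verts G \<and> card (A \<inter> B) = 1}"
    then obtain a b where ab: "a \<in> verts G" "b \<in> verts G" "p = (g a, g b)" "card (g a \<inter> g b) = 1" by auto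
    then have "a \<rightarrow>\<^bsub>G\<^esub> b" using adj by simp
    then obtain e where "e \<in> arcs G" "tail G e = a" "head G e = b" by (rule reachableE)
    then show "p \<in> iso_arcs f ` arcs G" using ab by (auto simp: f_def intro!: image_eqI[of _ _ e])
  qed
  then have "triangular_graph m = app_iso f G"
    by (auto simp: triangular_graph_def Let_def app_iso_def f_def g(2))
  ultimately show ?thesis unfolding digraph_iso_def by blast
qed

lemma (in graph) triangular_graph_iso_bij:
  assumes "digraph_iso G (triangular_graph m)"
  obtains g where "bij_betw g (verts G) {A. A \<subseteq> {1..m} \<and> card A = 2}"
    "\<And>a b. a \<in> verts G \<Longrightarrow> b \<in> verts G \<Longrightarrow> a \<rightarrow>\<^bsub>G\<^esub> b \<longleftrightarrow> card (g a \<inter> g b) = 1"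
proof -
  obtain f where f: "digraph_isomorphism f" "triangular_graph m = app_iso f G"
    using assms by (auto simp: digraph_iso_def)
  define g where "g = iso_verts f"
  let ?T = "{A. A \<subseteq> {1..m} \<and> card A = 2}"
  have "verts (app_iso f G) = ?T" "arcs (app_iso f G) = {(A, B) \<in> ?T \<times> ?T. card (A \<inter> B) = 1}"
    "tail (app_iso f G) = fst" "head (app_iso f G) = snd"
    unfolding f(2)[symmetric] by (simp_all add: triangular_graph_def Let_def)
  then have H: "g ` verts G = ?T" "iso_arcs f ` arcs G = {(A, B) \<in> ?T \<times> ?T. card (A \<inter> B) = 1}"
    "iso_tail f = fst" "iso_head f = snd"
    by (simp_all add: g_def)
  have inj: "inj_on g (verts G)" using f(1) by (simp add: digraph_isomorphism_def g_def)
  have arc: "iso_arcs f e = (g (tail G e), g (head G e))" if "e \<in> arcs G" for e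
    using iso_verts_tail[OF f(1) that] iso_verts_head[OF f(1) that] H(3,4) by (simp add: g_def prod_eq_iff)
  have "a \<rightarrow>\<^bsub>G\<^esub> b \<longleftrightarrow> card (g a \<inter> g b) = 1" if ab: "a \<in> verts G" "b \<in> verts G" for a b
  proof
    assume "a \<rightarrow>\<^bsub>G\<^esub> b"
    then obtain e where "e \<in> arcs G" "tail G e = a" "head G e = b" by (rule reachableE)
    then have "(g a, g b) \<in> iso_arcs f ` arcs G" using arc[of e] by force
    then show "card (g a \<inter> g b) = 1" unfolding H(2) by simp
  next
    assume "card (g a \<inter> g b) = 1"
    then have "(g a, g b) \<in> iso_arcs f ` arcs G" unfolding H(2) using H(1) ab by auto
    then obtain e where e: "e \<in> arcs G" "(g a, g b) = iso_arcs f e" by blast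
    then have "tail G e = a" "head G e = b" using arc[OF e(1)] inj ab by (auto simp: inj_on_eq_iff)
    then show "a \<rightarrow>\<^bsub>G\<^esub> b" using e(1) by (auto simp: arcs_ends_conv)
  qed
  then show ?thesis using that[of g] inj H(1) by (simp add: bij_betw_def)
qed

text \<open>\<open>A\<close> is the component of one vertex \<open>u\<close> and \<open>B\<close>
  the union of all others. In a strong component with two vertices every vertex starts an arc, and
  this arc cannot leave its side.\<close>

lemma (in graph) disconnecting_set_cut:
  assumes "disconnecting_set G S"
    and "\<And>C. C \<in> pre_digraph.sccs (G \<restriction> (verts G - S)) \<Longrightarrow> 2 \<le> card (verts C)"
  obtains A B where "A \<union> B = verts G - S" "A \<inter> B = {}" "A \<noteq> {}" "B \<noteq> {}"
    "\<And>a b. a \<in> A \<Longrightarrow> b \<in> B \<Longrightarrow> \<not> a \<rightarrow>\<^bsub>G\<^esub> b"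
    "\<And>a. a \<in> A \<Longrightarrow> \<exists>a'\<in>A. a \<rightarrow>\<^bsub>G\<^esub> a'" "\<And>b. b \<in> B \<Longrightarrow> \<exists>b'\<in>B. b \<rightarrow>\<^bsub>G\<^esub> b'"
proof -
  define H where "H = G \<restriction> (verts G - S)"
  interpret H: wf_digraph H unfolding H_def by auto
  have adjH: "a \<rightarrow>\<^bsub>H\<^esub> b \<longleftrightarrow> a \<in> verts H \<and> b \<in> verts H \<and> a \<rightarrow>\<^bsub>G\<^esub> b" for a b
    by (auto simp: H_def arcs_ends_conv)
  have vH: "verts H = verts G - S" by (simp add: H_def)
  have ne: "verts H \<noteq> {}" using assms(1) by (auto simp: vH disconnecting_set_def)
  have "\<not> Digraph_Component.connected H" using assms(1) by (simp add: H_def disconnecting_set_def)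
  then obtain u w where uw: "u \<in> verts H" "w \<in> verts H" "\<not> u \<rightarrow>\<^sup>*\<^bsub>H\<^esub> w"
    using H.connectedI[OF ne] H.reachable_mk_symmetricI by blast
  define A where "A = {x \<in> verts H. u \<rightarrow>\<^sup>*\<^bsub>H\<^esub> x}"
  define B where "B = verts H - A"
  have step: "b \<in> A" if "a \<in> A" "b \<in> verts H" "a \<rightarrow>\<^bsub>G\<^esub> b" for a b
    using that H.reachable_adj_trans[of u a b] by (auto simp: A_def adjH)
  have cross: "\<not> a \<rightarrow>\<^bsub>G\<^esub> b" if "a \<in> A" "b \<in> B" for a b
    using step[OF that(1), of b] that by (auto simp: B_def)
  have nb: "\<exists>y\<in>verts H. x \<rightarrow>\<^bsub>G\<^esub> y" if "x \<in> verts H" for x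
  proof -
    have "H.scc_of x \<in> H.sccs_verts" using H.scc_of_in_sccs_verts[OF that] .
    then have "H \<restriction> H.scc_of x \<in> H.sccs" by (rule H.in_verts_sccsD_sccs)
    then have "2 \<le> card (H.scc_of x)" using assms(2)[of "H \<restriction> H.scc_of x"] by (simp add: H_def)
    then have "\<not> H.scc_of x \<subseteq> {x}" using card_mono[of "{x}" "H.scc_of x"] by auto
    then obtain y where y: "y \<in> H.scc_of x" "y \<noteq> x" by blast
    then have "x \<rightarrow>\<^sup>*\<^bsub>H\<^esub> y" by (simp add: H.scc_of_def)
    then show ?thesis
      by (cases rule: H.converse_reachable_cases) (use y in \<open>auto simp: adjH\<close>)
  qed
  show ?thesis
  proof (rule that[of A B])
    show "A \<union> B = verts G - S" "A \<inter> B = {}" by (auto simp: A_def B_def vH)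
    show "A \<noteq> {}" using uw(1) by (auto simp: A_def)
    show "B \<noteq> {}" using uw by (auto simp: A_def B_def)
    show "\<not> a \<rightarrow>\<^bsub>G\<^esub> b" if "a \<in> A" "b \<in> B" for a b using cross[OF that] .
    show "\<exists>a'\<in>A. a \<rightarrow>\<^bsub>G\<^esub> a'" if "a \<in> A" for a
    proof -
      obtain y where "y \<in> verts H" "a \<rightarrow>\<^bsub>G\<^esub> y" using nb[of a] \<open>a \<in> A\<close> by (auto simp: A_def)
      then show ?thesis using step[OF that] by blast
    qed
    show "\<exists>b'\<in>B. b \<rightarrow>\<^bsub>G\<^esub> b'" if "b \<in> B" for b
    proof -
      obtain y where y: "y \<in> verts H" "b \<rightarrow>\<^bsub>G\<^esub> y" using nb[of b] \<open>b \<in> B\<close> by (auto simp: B_def)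
      have "y \<notin> A" using cross[of y b] graph_symmetric[OF y(2)] that by blast
      then show ?thesis using y by (auto simp: B_def)
    qed
  qed
qed

lemma counterexample_imp_triangular:
  assumes "srg G v k l \<mu>" "graph_eigenvalue G (-2)" "Digraph_Component.connected G"
    and "disconnecting_set G S"
    and "\<And>C. C \<in> pre_digraph.sccs (G \<restriction> (verts G - S)) \<Longrightarrow> 2 \<le> card (verts C)"
    and S: "int (card S) < 2 * int k - int l - 2"
  shows "\<exists>m\<ge>6. digraph_iso G (triangular_graph m)"
proof -
  interpret graph G using assms(1) by (simp add: srg_def)
  let ?adj = "\<lambda>x y. x \<rightarrow>\<^bsub>G\<^esub> y"
  have nb: "neighbors G x = {w. ?adj x w}" for x using adj_in_verts by (auto simp: neighbors_def)
  have deg: "\<And>x. x \<in> verts G \<Longrightarrow> card {w. ?adj x w} = k"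
    and adj: "\<And>x y. ?adj x y \<Longrightarrow> card ({w. ?adj x w} \<inter> {w. ?adj y w}) = l"
    and nonadj: "\<And>x y. x \<in> verts G \<Longrightarrow> y \<in> verts G \<Longrightarrow> x \<noteq> y \<Longrightarrow> \<not> ?adj x y \<Longrightarrow>
        card ({w. ?adj x w} \<inter> {w. ?adj y w}) = \<mu>"
    using assms(1) adj_in_verts by (auto simp: srg_def nb)
  have fin: "finite {w. ?adj x w}" for x
    using finite_subset[of "{w. ?adj x w}" "verts G"] adj_in_verts by auto
  obtain A B where AB: "A \<union> B = verts G - S" "A \<inter> B = {}" "A \<noteq> {}" "B \<noteq> {}"
    and cross: "\<And>a b. a \<in> A \<Longrightarrow> b \<in> B \<Longrightarrow> \<not> ?adj a b"
    and nA: "\<And>a. a \<in> A \<Longrightarrow> \<exists>a'\<in>A. ?adj a a'" and nB: "\<And>b. b \<in> B \<Longrightarrow> \<exists>b'\<in>B. ?adj b b'"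
    by (rule disconnecting_set_cut[OF assms(4,5)]) blast+
  obtain a b where ab: "a \<in> A" "b \<in> B" using AB by blast
  have abV: "a \<in> verts G" "b \<in> verts G" "a \<noteq> b" "\<not> ?adj a b" using ab AB cross by blast+
  \<comment> \<open>Otherwise \<open>a\<close> and its neighbours would be closed under adjacency,
    hence everything, but \<open>b\<close> is not among them. The path shows
    \<open>\<mu> > 0\<close>, and also \<open>l + 2 \<le> k\<close>, since \<open>a\<close> and
    \<open>y\<close> are neighbours of \<open>x\<close> but not common neighbours of
    \<open>x\<close> and \<open>a\<close>.\<close>
  obtain x y where xy: "?adj a x" "?adj x y" "y \<noteq> a" "\<not> ?adj a y"
  proof -
    have "\<not> (\<forall>x y. x \<in> insert a {w. ?adj a w} \<longrightarrow> ?adj x y \<longrightarrow> y \<in> insert a {w. ?adj a w})"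
    proof
      assume "\<forall>x y. x \<in> insert a {w. ?adj a w} \<longrightarrow> ?adj x y \<longrightarrow> y \<in> insert a {w. ?adj a w}"
      then have eq: "insert a {w. ?adj a w} = verts G"
        using abV(1) adj_in_verts by (intro connected_closed[OF assms(3)]) blast+
      have "b \<in> insert a {w. ?adj a w}" unfolding eq by (rule abV(2))
      then show False using abV(3,4) by simp
    qed
    then show ?thesis using that by blast
  qed
  have xa: "?adj x a" using xy(1) by (rule graph_symmetric)
  have ya: "?adj y x" using xy(2) by (rule graph_symmetric)
  have mu: "\<mu> > 0"
  proof -
    have "x \<in> {w. ?adj a w} \<inter> {w. ?adj y w}" using xy ya by blast
    then have "card ({w. ?adj a w} \<inter> {w. ?adj y w}) \<noteq> 0" using fin by auto
    then show ?thesis using nonadj[of a y] xy adj_in_verts by (metis not_gr_zero)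
  qed
  have lk: "l + 2 \<le> k"
  proof -
    have "card (insert a (insert y ({w. ?adj x w} \<inter> {w. ?adj a w}))) \<le> card {w. ?adj x w}"
      using xa xy by (intro card_mono fin) auto
    moreover have "a \<notin> {w. ?adj x w} \<inter> {w. ?adj a w}" using adj_not_same by auto
    moreover have "y \<notin> {w. ?adj x w} \<inter> {w. ?adj a w}" using xy by auto
    ultimately show ?thesis
      using adj[OF xa] deg[of x] adj_in_verts(1)[OF xa] xy(3) fin by simp
  qed
  \<comment> \<open>This is the second root of \<open>t^2 - (l - \<mu>) t - (k - \<mu>)\<close>,
    whose first root is -2.\<close>
  define r where "r = k - l - 2"
  have eig: "k + \<mu> = 2 * l + 4" using srg_eigenvalue_neg2[OF assms(1,2)] .
  have k: "k = 2 * r + \<mu>" and l: "l + 2 = r + \<mu>" using eig lk by (simp_all add: r_def)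
  interpret s: srg_neg2 "verts G" ?adj r \<mu>
  proof
    show "card {w. ?adj x w} = 2 * r + \<mu>" if "x \<in> verts G" for x using deg[OF that] k by simp
    show "card ({w. ?adj x w} \<inter> {w. ?adj y w}) + 2 = r + \<mu>" if "?adj x y" for x y using adj[OF that] l by simp
  qed (use graph_symmetric adj_not_same adj_in_verts nonadj mu in auto)
  have SV: "S \<subseteq> verts G" using assms(4) by (simp add: disconnecting_set_def)
  have "card (verts G) = card (verts G - S) + card S"
    using SV finite_subset[OF SV] by (simp add: card_Diff_subset card_mono)
  moreover have "finite A" "finite B" using AB(1) finite_verts by (metis finite_Diff finite_Un)+
  then have "card (verts G - S) = card A + card B" using AB(1,2) by (metis card_Un_disjoint)
  moreover have "card S < 3 * r + \<mu>" using S k l by linarith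
  ultimately have "card (verts G) < card A + card B + 3 * r + \<mu>" by linarith
  then have cut: "s.small_cut A B"
    unfolding s.small_cut_def using AB cross nA nB by blast
  have "\<exists>g :: 'a \<Rightarrow> nat set. bij_betw g (verts G) {A. A \<subseteq> {1..r + 4} \<and> card A = 2} \<and>
    (\<forall>a\<in>verts G. \<forall>b\<in>verts G. ?adj a b \<longleftrightarrow> card (g a \<inter> g b) = 1)"
    using cut by (rule s.small_cut_triangular) (rule connected_closed[OF assms(3)])
  then have "digraph_iso G (triangular_graph (r + 4))"
    using digraph_iso_triangular_graph by blast
  then show ?thesis using s.small_cut_r_ge_2[OF cut] by (intro exI[of _ "r + 4"]) simp
qed

text \<open>The estimates \<open>k \<ge> 2 (m - 2)\<close> and \<open>l \<le> m - 2\<close> give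
  \<open>2k - l - 2 \<ge> 3m - 8\<close>, one more than the bound \<open>3 (m - 3)\<close> on the
  size of the cut.\<close>

lemma triangular_imp_counterexample:
  assumes "srg G v k l \<mu>" "Digraph_Component.connected G" "m \<ge> 6" "digraph_iso G (triangular_graph m)"
  shows "brouwer_counterexample G"
proof -
  interpret graph G using assms(1) by (simp add: srg_def)
  let ?T = "{A. A \<subseteq> {1..m} \<and> card A = 2}"
  obtain g where g: "bij_betw g (verts G) ?T"
    and adj: "\<And>a b. a \<in> verts G \<Longrightarrow> b \<in> verts G \<Longrightarrow> a \<rightarrow>\<^bsub>G\<^esub> b \<longleftrightarrow> card (g a \<inter> g b) = 1"
    by (rule triangular_graph_iso_bij[OF assms(4)]) blast
  have inj: "inj_on g (verts G)" and im: "g ` verts G = ?T" using g by (auto simp: bij_betw_def)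
  have gT: "g x \<subseteq> {1..m}" "card (g x) = 2" "finite (g x)" if "x \<in> verts G" for x
  proof -
    have "g x \<in> ?T" using that im by blast
    then show "g x \<subseteq> {1..m}" "card (g x) = 2" "finite (g x)" by (auto intro: finite_subset)
  qed
  have pair: "{i, j} \<in> ?T" if "i \<noteq> j" "i \<in> {1..m}" "j \<in> {1..m}" for i j
    using that by auto
  have vert: "\<exists>x\<in>verts G. g x = {i, j}" if "i \<noteq> j" "i \<in> {1..m}" "j \<in> {1..m}" for i j
    using pair[OF that] im by (metis (no_types, lifting) imageE)
  have nb: "g ` neighbors G x = {B \<in> ?T. card (g x \<inter> B) = 1}" if "x \<in> verts G" for x
  proof -
    have "neighbors G x = {w \<in> verts G. card (g x \<inter> g w) = 1}" using adj that by (auto simp: neighbors_def)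
    then show ?thesis unfolding im[symmetric] by auto
  qed
  have nbV: "neighbors G x \<subseteq> verts G" for x by (auto simp: neighbors_def)
  have cardg: "card (g ` X) = card X" if "X \<subseteq> verts G" for X
    using inj_on_subset[OF inj that] by (rule card_image)
  have finT: "finite ?T" by simp
  obtain x12 where x12: "x12 \<in> verts G" "g x12 = {1, 2}" using vert[of 1 2] assms(3) by auto
  obtain x13 where x13: "x13 \<in> verts G" "g x13 = {1, 3}" using vert[of 1 3] assms(3) by auto
  obtain x45 where x45: "x45 \<in> verts G" "g x45 = {4, 5}" using vert[of 4 5] assms(3) by auto
  have k: "k \<ge> 2 * (m - 2)"
  proof -
    let ?P = "{1, 2 :: nat} \<times> {3..m}" and ?f = "\<lambda>(i, j). {i, j :: nat}"
    have "inj_on ?f ?P" by (auto simp: inj_on_def doubleton_eq_iff)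
    then have "card (?f ` ?P) = card ?P" by (rule card_image)
    also have "\<dots> = 2 * (m - 2)" by (simp add: card_cartesian_product numeral_3_eq_3)
    finally have "2 * (m - 2) = card (?f ` ?P)" ..
    also have "?f ` ?P \<subseteq> g ` neighbors G x12"
    proof
      fix B assume "B \<in> ?f ` ?P"
      then obtain i j where B: "B = {i, j}" "i = 1 \<or> i = 2" "3 \<le> j" "j \<le> m" by auto
      have "{1, 2} \<inter> B = {i}" using B by auto
      moreover have "B \<in> ?T" using B pair[of i j] by auto
      ultimately show "B \<in> g ` neighbors G x12" by (simp add: nb[OF x12(1)] x12(2))
    qed
    then have "card (?f ` ?P) \<le> card (g ` neighbors G x12)"
      using finite_subset[OF nbV] by (intro card_mono) auto
    also have "\<dots> = k" using cardg[OF nbV] assms(1) x12(1) by (simp add: srg_def)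
    finally show ?thesis .
  qed
  have l: "l \<le> m - 2"
  proof -
    have "card ({1, 2} \<inter> {1, 3 :: nat}) = 1" by simp
    then have a: "x12 \<rightarrow>\<^bsub>G\<^esub> x13" using adj[OF x12(1) x13(1)] by (simp only: x12 x13)
    have "g ` (neighbors G x12 \<inter> neighbors G x13) \<subseteq> insert {2, 3} ((\<lambda>j. {1, j}) ` {4..m})"
    proof
      fix B assume "B \<in> g ` (neighbors G x12 \<inter> neighbors G x13)"
      then have "B \<in> g ` neighbors G x12" "B \<in> g ` neighbors G x13" by blast+
      then have B: "B \<subseteq> {1..m}" "card B = 2" "card ({1, 2} \<inter> B) = 1" "card ({1, 3} \<inter> B) = 1"
        by (simp_all add: nb[OF x12(1)] nb[OF x13(1)] x12(2) x13(2))
      obtain p q where pq: "B = {p, q}" "p \<noteq> q" using B(2) by (auto simp: card_2_iff)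
      have pm: "1 \<le> p" "p \<le> m" "1 \<le> q" "q \<le> m" using B(1) pq by auto
      have "(p = 1 \<or> p = 2) \<noteq> (q = 1 \<or> q = 2)" "(p = 1 \<or> p = 3) \<noteq> (q = 1 \<or> q = 3)"
        using B(3,4) pq by (auto simp: Int_insert_right split: if_splits)
      then consider "p = 1" "q \<ge> 4" | "q = 1" "p \<ge> 4" | "p = 2" "q = 3" | "p = 3" "q = 2"
        using pm pq(2) by (cases "p = 1"; cases "q = 1"; force)
      then show "B \<in> insert {2, 3} ((\<lambda>j. {1, j}) ` {4..m})"
        using pm by cases (auto simp: pq(1) insert_commute)
    qed
    then have "card (g ` (neighbors G x12 \<inter> neighbors G x13)) \<le> card (insert {2, 3} ((\<lambda>j. {1, j}) ` {4..m}))"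
      by (intro card_mono) auto
    also have "\<dots> \<le> Suc (card ((\<lambda>j. {1, j}) ` {4..m}))" by (rule card_insert_le_m1) auto
    also have "\<dots> \<le> Suc (card {4..m})" by (simp only: Suc_le_mono) (rule card_image_le, simp)
    also have "\<dots> \<le> m - 2" using assms(3) by simp
    finally have "card (g ` (neighbors G x12 \<inter> neighbors G x13)) \<le> m - 2" .
    moreover have "card (g ` (neighbors G x12 \<inter> neighbors G x13)) = l"
      using cardg[of "neighbors G x12 \<inter> neighbors G x13"] nbV assms(1) x12(1) x13(1) a
      by (auto simp: srg_def)
    ultimately show ?thesis by simp
  qed
  \<comment> \<open>Removing the pairs that meet \<open>Z\<close> in one point leaves the pairs
    inside \<open>Z\<close>, which form the triangle cut off, and the pairs disjoint from
    \<open>Z\<close>.\<close>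
  define Z :: "nat set" where "Z = {1, 2, 3}"
  define S where "S = {x \<in> verts G. card (g x \<inter> Z) = 1}"
  have SV: "S \<subseteq> verts G" by (auto simp: S_def)
  have "card S \<le> 3 * (m - 3)"
  proof -
    let ?P = "Z \<times> {4..m}" and ?f = "\<lambda>(i, j). {i, j :: nat}"
    have "g ` S \<subseteq> ?f ` ?P"
    proof
      fix B assume "B \<in> g ` S"
      then have B: "B \<subseteq> {1..m}" "card B = 2" "card (B \<inter> Z) = 1" using gT by (auto simp: S_def)
      obtain i where i: "B \<inter> Z = {i}" using B(3) by (auto simp: card_1_singleton_iff)
      obtain p q where pq: "B = {p, q}" "p \<noteq> q" using B(2) by (auto simp: card_2_iff)
      have ge: "n \<in> {4..m}" if "n \<in> B" "n \<notin> Z" for n using that B(1) by (force simp: Z_def)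
      have "i = p \<or> i = q" using i pq by blast
      then show "B \<in> ?f ` ?P"
      proof
        assume "i = p"
        then have "p \<in> Z" "q \<notin> Z" using i pq by auto
        then have "(p, q) \<in> ?P" using ge[of q] pq by auto
        then show ?thesis using pq by (intro image_eqI[of _ _ "(p, q)"]) auto
      next
        assume "i = q"
        then have "q \<in> Z" "p \<notin> Z" using i pq by auto
        then have "(q, p) \<in> ?P" using ge[of p] pq by auto
        then show ?thesis using pq by (intro image_eqI[of _ _ "(q, p)"]) auto
      qed
    qed
    then have "card (g ` S) \<le> card (?f ` ?P)" by (intro card_mono) (auto simp: Z_def)
    also have "\<dots> \<le> card ?P" by (rule card_image_le) (simp add: Z_def)
    also have "\<dots> = 3 * (m - 3)" by (simp add: card_cartesian_product Z_def)
    finally show ?thesis using cardg[OF SV] by simp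
  qed
  then have small: "int (card S) < 2 * int k - int l - 2" using k l assms(3) by linarith
  define H where "H = G \<restriction> (verts G - S)"
  interpret H: wf_digraph H unfolding H_def by auto
  have adjH: "a \<rightarrow>\<^bsub>H\<^esub> b \<longleftrightarrow> a \<in> verts H \<and> b \<in> verts H \<and> a \<rightarrow>\<^bsub>G\<^esub> b" for a b
    by (auto simp: H_def arcs_ends_conv)
  have vH: "verts H = verts G - S" by (simp add: H_def)
  have dich: "g x \<subseteq> Z \<or> g x \<inter> Z = {}" if "x \<in> verts H" for x
  proof -
    have x: "x \<in> verts G" "card (g x \<inter> Z) \<noteq> 1" using that by (auto simp: vH S_def)
    have "card (g x \<inter> Z) \<le> 2" using card_mono[of "g x" "g x \<inter> Z"] gT[OF x(1)] by simp
    then consider "card (g x \<inter> Z) = 0" | "card (g x \<inter> Z) = 2" using x(2) by linarith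
    then show ?thesis
    proof cases
      case 1
      then show ?thesis using gT[OF x(1)] by simp
    next
      case 2
      then have "g x \<inter> Z = g x" using gT[OF x(1)] by (intro card_subset_eq) auto
      then show ?thesis by blast
    qed
  qed
  have inH: "x \<in> verts H" if "x \<in> verts G" "g x \<subseteq> Z \<or> g x \<inter> Z = {}" for x
  proof -
    have "card (g x \<inter> Z) \<noteq> 1" using that gT[OF that(1)] by (auto simp: Int_absorb2)
    then show ?thesis using that by (auto simp: vH S_def)
  qed
  have x12H: "x12 \<in> verts H" and x45H: "x45 \<in> verts H"
    by (rule inH; simp add: x12 x45 Z_def)+
  have reach: "g y \<subseteq> Z" if "x12 \<rightarrow>\<^sup>*\<^bsub>H\<^esub> y" for y
    using that
  proof (induction rule: H.reachable_induct)
    case base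
    then show ?case by (simp add: x12 Z_def)
  next
    case (step x y)
    have xy: "x \<in> verts H" "y \<in> verts H" "x \<rightarrow>\<^bsub>G\<^esub> y" using step.hyps(2) by (auto simp: adjH)
    then have "card (g x \<inter> g y) = 1" using adj by (auto simp: vH)
    then have "g x \<inter> g y \<noteq> {}" by auto
    then show ?case using dich[OF xy(2)] step.IH by blast
  qed
  have symH: "symmetric H"
    using graph_symmetric by (auto simp: symmetric_def adjH intro!: symI)
  have "\<not> Digraph_Component.connected H"
  proof
    assume "Digraph_Component.connected H"
    then have "strongly_connected H" by (rule H.symmetric_connected_imp_strongly_connected[OF symH])
    then have "x12 \<rightarrow>\<^sup>*\<^bsub>H\<^esub> x45" using x12H x45H by (simp add: strongly_connected_def)
    then show False using reach[of x45] by (simp add: x45 Z_def)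
  qed
  then have disc: "disconnecting_set G S"
    using SV x12H by (auto simp: disconnecting_set_def H_def)
  have "2 \<le> card (verts C)" if C: "C \<in> H.sccs" for C
  proof -
    have CV: "verts C \<in> H.sccs_verts" using C by (simp add: H.sccs_verts_conv)
    then obtain x where x: "x \<in> verts C" by (auto simp: H.in_sccs_verts_conv_reachable)
    have sub: "verts C \<subseteq> verts H" using H.sccs_verts_subsets[OF CV] .
    have xH: "x \<in> verts H" and xG: "x \<in> verts G" using x sub by (auto simp: vH)
    \<comment> \<open>The point set of the side of \<open>x\<close>. Either choice has at least 3
      points, the complement of \<open>Z\<close> because \<open>m \<ge> 6\<close>, so there is room
      to replace one point of \<open>g x\<close> by another point \<open>c\<close> and obtain a
      neighbour on the same side.\<close>
    define W where "W = (if g x \<subseteq> Z then Z else {1..m} - Z)"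
    have W: "g x \<subseteq> W" "W \<subseteq> {1..m}" "W \<subseteq> Z \<or> W \<inter> Z = {}" "card W \<ge> 3"
    proof -
      show "g x \<subseteq> W" using dich[OF xH] gT(1)[OF xG] by (auto simp: W_def)
      show "W \<subseteq> {1..m}" using assms(3) by (auto simp: W_def Z_def)
      show "W \<subseteq> Z \<or> W \<inter> Z = {}" by (auto simp: W_def)
      have "card ({1..m} - Z) = m - 3" using assms(3) by (subst card_Diff_subset) (auto simp: Z_def)
      then show "card W \<ge> 3" using assms(3) by (auto simp: W_def Z_def)
    qed
    obtain i where i: "i \<in> g x" using gT(2)[OF xG] by fastforce
    have "\<not> W \<subseteq> g x" using card_mono[OF gT(3)[OF xG], of W] gT(2)[OF xG] W(4) by auto
    then obtain c where c: "c \<in> W" "c \<notin> g x" by blast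
    have ic: "i \<noteq> c" using i c by blast
    obtain w where w: "w \<in> verts G" "g w = {i, c}" using vert[of i c] ic i c W by blast
    have "g x \<inter> g w = {i}" using w(2) i c by auto
    then have xw: "x \<rightarrow>\<^bsub>G\<^esub> w" using adj[OF xG w(1)] by simp
    have wH: "w \<in> verts H" using w i c W by (intro inH) auto
    have "x \<rightarrow>\<^sup>*\<^bsub>H\<^esub> w" "w \<rightarrow>\<^sup>*\<^bsub>H\<^esub> x"
      using xw graph_symmetric[OF xw] xH wH by (auto simp: adjH intro!: H.reachable_adjI)
    then have "w \<in> verts C" using CV x by (auto simp: H.in_sccs_verts_conv_reachable)
    moreover have "x \<noteq> w" using xw adj_not_same by blast
    moreover have "finite (verts C)" using sub by (rule finite_subset) (simp add: vH)
    ultimately show ?thesis using x card_mono[of "verts C" "{x, w}"] by auto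
  qed
  then have "\<forall>C\<in>pre_digraph.sccs (G \<restriction> (verts G - S)). 2 \<le> card (verts C)"
    by (simp add: H_def)
  then show ?thesis
    unfolding brouwer_counterexample_def using assms(1,2) disc small by blast
qed

theorem proposition10p7:
  fixes G :: "('a, 'b) pre_digraph"
  assumes "Digraph_Component.connected G"
    and "strongly_regular G"
    and "smallest_eigenvalue G (-2)"
  shows "brouwer_counterexample G \<longleftrightarrow> (\<exists>m \<ge> 6. digraph_iso G (triangular_graph m))"
proof
  assume "brouwer_counterexample G"
  then show "\<exists>m \<ge> 6. digraph_iso G (triangular_graph m)"
    using counterexample_imp_triangular assms(3)
    unfolding brouwer_counterexample_def smallest_eigenvalue_def by blast
next
  assume "\<exists>m \<ge> 6. digraph_iso G (triangular_graph m)"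
  then show "brouwer_counterexample G"
    using triangular_imp_counterexample assms(1,2) unfolding strongly_regular_def by blast
qed

end
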